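(* Let $\mathcal{C}$ be a model category, with functorial cofibrant and fibrant replacements $Q$ and $R$. The localization of $\mathcal{C}$ with respect to the weak equivalences can be constructed as the category with the same objects as $\mathcal{C}$ and with arrows from $X$ to $Y$ the homotopical classes in $\mathcal{C}_{fc}$ of arrows from $RQX$ to $RQY$. The localization functor is the identity on objects and maps an arrow $f$ to the class of $RQf$.
   Context: $\mathcal{C}_c$ and $\mathcal{C}_{fc}$ are the full subcategories of $\mathcal{C}$ of cofibrant objects and of fibrant-cofibrant objects. $Q:\mathcal{C}\to\mathcal{C}$ is a weak-equivalence-preserving functor with $QX$ cofibrant for all $X$, with a natural transformation $Q\Rightarrow id_{\mathcal{C}}$ whose components are weak equivalences; $R:\mathcal{C}_c\to\mathcal{C}_c$ is a weak-equivalence-preserving functor with $RX$ fibrant-cofibrant for all cofibrant $X$, with a natural transformation $id_{\mathcal{C}_c}\Rightarrow R$ whose components are weak equivalences. The homotopical classes in $\mathcal{C}_{fc}$ are the classes of arrows of $\mathcal{C}_{fc}$ for the relation: $f\sim g$ if and only if $\gamma_0f=\gamma_0g$, where $\gamma_0:\mathcal{C}_{fc}\to Ho(\mathcal{C}_{fc})$ is the localization of $\mathcal{C}_{fc}$ with respect to its weak equivalences (those of $\mathcal{C}$ between objects of $\mathcal{C}_{fc}$). Composition and identities are those of the quotient category $\mathcal{C}_{fc}/{\sim}$. The localization of a category with respect to a family of arrows is the functor universal (with unique strict factorization) among those sending these arrows to isomorphisms; size issues are ignored. *)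

theory Defs
  imports Main
begin

record ('o, 'a) cat =
  Obj :: "'o set"
  Arr :: "'a set"
  Dom :: "'a \<Rightarrow> 'o"
  Cod :: "'a \<Rightarrow> 'o"
  Ide :: "'o \<Rightarrow> 'a"
  Cmp :: "'a \<Rightarrow> 'a \<Rightarrow> 'a"  (infixl "\<cdot>\<index>" 70)  \<comment> \<open>\<open>g \<cdot> f\<close> is first \<open>f\<close>, then \<open>g\<close>\<close>

definition hom :: "('o, 'a) cat \<Rightarrow> 'o \<Rightarrow> 'o \<Rightarrow> 'a set" where
  "hom C X Y = {f \<in> Arr C. Dom C f = X \<and> Cod C f = Y}"

locale category =
  fixes C :: "('o, 'a) cat" (structure)
  assumes dom_in: "f \<in> Arr C \<Longrightarrow> Dom C f \<in> Obj C"
    and cod_in: "f \<in> Arr C \<Longrightarrow> Cod C f \<in> Obj C"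
    and ide_in: "X \<in> Obj C \<Longrightarrow> Ide C X \<in> hom C X X"
    and cmp_in: "f \<in> hom C X Y \<Longrightarrow> g \<in> hom C Y Z \<Longrightarrow> g \<cdot> f \<in> hom C X Z"
    and ide_left: "f \<in> hom C X Y \<Longrightarrow> Ide C Y \<cdot> f = f"
    and ide_right: "f \<in> hom C X Y \<Longrightarrow> f \<cdot> Ide C X = f"
    and cmp_assoc: "f \<in> hom C X Y \<Longrightarrow> g \<in> hom C Y Z \<Longrightarrow> h \<in> hom C Z V
      \<Longrightarrow> (h \<cdot> g) \<cdot> f = h \<cdot> (g \<cdot> f)"

definition is_iso :: "('o, 'a) cat \<Rightarrow> 'a \<Rightarrow> bool" where
  "is_iso C f \<longleftrightarrow> f \<in> Arr C \<and> (\<exists>g \<in> hom C (Cod C f) (Dom C f).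
     g \<cdot>\<^bsub>C\<^esub> f = Ide C (Dom C f) \<and> f \<cdot>\<^bsub>C\<^esub> g = Ide C (Cod C f))"

definition op_cat :: "('o, 'a) cat \<Rightarrow> ('o, 'a) cat" where
  "op_cat C = \<lparr>Obj = Obj C, Arr = Arr C, Dom = Cod C, Cod = Dom C, Ide = Ide C,
     Cmp = (\<lambda>g f. f \<cdot>\<^bsub>C\<^esub> g)\<rparr>"

definition full_subcat :: "('o, 'a) cat \<Rightarrow> ('o \<Rightarrow> bool) \<Rightarrow> ('o, 'a) cat" where
  "full_subcat C P = C\<lparr>Obj := {X \<in> Obj C. P X}, Arr := {f \<in> Arr C. P (Dom C f) \<and> P (Cod C f)}\<rparr>"

record ('o, 'a, 'p, 'b) cfunctor =
  omap :: "'o \<Rightarrow> 'p"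
  amap :: "'a \<Rightarrow> 'b"

definition is_functor :: "('o, 'a) cat \<Rightarrow> ('p, 'b) cat \<Rightarrow> ('o, 'a, 'p, 'b) cfunctor \<Rightarrow> bool" where
  "is_functor C D F \<longleftrightarrow> category C \<and> category D
     \<and> (\<forall>X\<in>Obj C. omap F X \<in> Obj D)
     \<and> (\<forall>f\<in>Arr C. amap F f \<in> hom D (omap F (Dom C f)) (omap F (Cod C f)))
     \<and> (\<forall>X\<in>Obj C. amap F (Ide C X) = Ide D (omap F X))
     \<and> (\<forall>f\<in>Arr C. \<forall>g\<in>Arr C. Cod C f = Dom C g \<longrightarrow> amap F (g \<cdot>\<^bsub>C\<^esub> f) = amap F g \<cdot>\<^bsub>D\<^esub> amap F f)"

text \<open>Equality of functors out of \<open>C\<close>; the values outside the carriers of \<open>C\<close> are irrelevant.\<close>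

definition functor_eq ::
    "('o, 'a) cat \<Rightarrow> ('o, 'a, 'p, 'b) cfunctor \<Rightarrow> ('o, 'a, 'p, 'b) cfunctor \<Rightarrow> bool" where
  "functor_eq C F G \<longleftrightarrow>
     (\<forall>X\<in>Obj C. omap F X = omap G X) \<and> (\<forall>f\<in>Arr C. amap F f = amap G f)"

definition id_functor :: "('o, 'a, 'o, 'a) cfunctor" where
  "id_functor = \<lparr>omap = (\<lambda>X. X), amap = (\<lambda>f. f)\<rparr>"

definition comp_functor ::
    "('p, 'b, 'q, 'c) cfunctor \<Rightarrow> ('o, 'a, 'p, 'b) cfunctor \<Rightarrow> ('o, 'a, 'q, 'c) cfunctor" where
  "comp_functor G F = \<lparr>omap = (\<lambda>X. omap G (omap F X)), amap = (\<lambda>f. amap G (amap F f))\<rparr>"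

definition is_nat_trans :: "('o, 'a) cat \<Rightarrow> ('p, 'b) cat \<Rightarrow>
    ('o, 'a, 'p, 'b) cfunctor \<Rightarrow> ('o, 'a, 'p, 'b) cfunctor \<Rightarrow> ('o \<Rightarrow> 'b) \<Rightarrow> bool" where
  "is_nat_trans C D F G \<eta> \<longleftrightarrow> is_functor C D F \<and> is_functor C D G
     \<and> (\<forall>X\<in>Obj C. \<eta> X \<in> hom D (omap F X) (omap G X))
     \<and> (\<forall>f\<in>Arr C. \<eta> (Cod C f) \<cdot>\<^bsub>D\<^esub> amap F f = amap G f \<cdot>\<^bsub>D\<^esub> \<eta> (Dom C f))"

definition inverts :: "('o, 'a) cat \<Rightarrow> 'a set \<Rightarrow> ('p, 'b) cat \<Rightarrow> ('o, 'a, 'p, 'b) cfunctor \<Rightarrow> bool" where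
  "inverts C W D F \<longleftrightarrow> is_functor C D F \<and> (\<forall>w\<in>W. is_iso D (amap F w))"

text \<open>
  A HOL formula cannot quantify over types, so the types \<open>'x, 'y\<close> of the objects and arrows of
  the target categories are parameters of the universal property; they are unconstrained type
  variables, so a polymorphic theorem covers targets of all types.
\<close>

definition is_localization :: "'x itself \<Rightarrow> 'y itself \<Rightarrow> ('o, 'a) cat \<Rightarrow> 'a set \<Rightarrow>
    ('p, 'b) cat \<Rightarrow> ('o, 'a, 'p, 'b) cfunctor \<Rightarrow> bool" where
  "is_localization _ _ C W D L \<longleftrightarrow> inverts C W D L
     \<and> (\<forall>(E :: ('x, 'y) cat) F. inverts C W E F \<longrightarrow>
          (\<exists>G. is_functor D E G \<and> functor_eq C (comp_functor G L) F
             \<and> (\<forall>G'. is_functor D E G' \<and> functor_eq C (comp_functor G' L) F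
                   \<longrightarrow> functor_eq D G' G)))"

definition is_cone :: "('j, 'k) cat \<Rightarrow> ('o, 'a) cat \<Rightarrow> ('j, 'k, 'o, 'a) cfunctor \<Rightarrow>
    'o \<Rightarrow> ('j \<Rightarrow> 'a) \<Rightarrow> bool" where
  "is_cone J C F X l \<longleftrightarrow> X \<in> Obj C \<and> (\<forall>j\<in>Obj J. l j \<in> hom C X (omap F j))
     \<and> (\<forall>k\<in>Arr J. amap F k \<cdot>\<^bsub>C\<^esub> l (Dom J k) = l (Cod J k))"

definition is_limit_cone :: "('j, 'k) cat \<Rightarrow> ('o, 'a) cat \<Rightarrow> ('j, 'k, 'o, 'a) cfunctor \<Rightarrow>
    'o \<Rightarrow> ('j \<Rightarrow> 'a) \<Rightarrow> bool" where
  "is_limit_cone J C F X l \<longleftrightarrow> is_cone J C F X l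
     \<and> (\<forall>Y m. is_cone J C F Y m \<longrightarrow> (\<exists>!u. u \<in> hom C Y X \<and> (\<forall>j\<in>Obj J. l j \<cdot>\<^bsub>C\<^esub> u = m j)))"

text \<open>Every finite category is isomorphic to one whose objects and arrows are natural numbers.\<close>

definition has_finite_limits :: "('o, 'a) cat \<Rightarrow> bool" where
  "has_finite_limits C \<longleftrightarrow>
     (\<forall>(J :: (nat, nat) cat) F. finite (Obj J) \<and> finite (Arr J) \<and> is_functor J C F
        \<longrightarrow> (\<exists>X l. is_limit_cone J C F X l))"

definition has_finite_colimits :: "('o, 'a) cat \<Rightarrow> bool" where
  "has_finite_colimits C \<longleftrightarrow> has_finite_limits (op_cat C)"

definition is_terminal :: "('o, 'a) cat \<Rightarrow> 'o \<Rightarrow> bool" where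
  "is_terminal C T \<longleftrightarrow> T \<in> Obj C \<and> (\<forall>X\<in>Obj C. \<exists>!f. f \<in> hom C X T)"

definition is_initial :: "('o, 'a) cat \<Rightarrow> 'o \<Rightarrow> bool" where
  "is_initial C I \<longleftrightarrow> I \<in> Obj C \<and> (\<forall>X\<in>Obj C. \<exists>!f. f \<in> hom C I X)"

definition wide_subcategory :: "('o, 'a) cat \<Rightarrow> 'a set \<Rightarrow> bool" where
  "wide_subcategory C S \<longleftrightarrow> S \<subseteq> Arr C \<and> (\<forall>X\<in>Obj C. Ide C X \<in> S)
     \<and> (\<forall>f\<in>S. \<forall>g\<in>S. Cod C f = Dom C g \<longrightarrow> g \<cdot>\<^bsub>C\<^esub> f \<in> S)"

definition is_retract :: "('o, 'a) cat \<Rightarrow> 'a \<Rightarrow> 'a \<Rightarrow> bool" where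
  "is_retract C f g \<longleftrightarrow> f \<in> Arr C \<and> g \<in> Arr C \<and>
     (\<exists>s \<in> hom C (Dom C f) (Dom C g). \<exists>r \<in> hom C (Dom C g) (Dom C f).
      \<exists>s' \<in> hom C (Cod C f) (Cod C g). \<exists>r' \<in> hom C (Cod C g) (Cod C f).
        r \<cdot>\<^bsub>C\<^esub> s = Ide C (Dom C f) \<and> r' \<cdot>\<^bsub>C\<^esub> s' = Ide C (Cod C f)
        \<and> g \<cdot>\<^bsub>C\<^esub> s = s' \<cdot>\<^bsub>C\<^esub> f \<and> f \<cdot>\<^bsub>C\<^esub> r = r' \<cdot>\<^bsub>C\<^esub> g)"

definition has_lifting :: "('o, 'a) cat \<Rightarrow> 'a \<Rightarrow> 'a \<Rightarrow> bool" where
  "has_lifting C i p \<longleftrightarrow>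
     (\<forall>u \<in> hom C (Dom C i) (Dom C p). \<forall>v \<in> hom C (Cod C i) (Cod C p).
        p \<cdot>\<^bsub>C\<^esub> u = v \<cdot>\<^bsub>C\<^esub> i \<longrightarrow>
        (\<exists>h \<in> hom C (Cod C i) (Dom C p). h \<cdot>\<^bsub>C\<^esub> i = u \<and> p \<cdot>\<^bsub>C\<^esub> h = v))"

text \<open>
  The axioms are those of Dwyer and Spalinski (Quillen's closed model categories): only finite
  limits and colimits are required, and the factorizations need not be functorial.
\<close>

locale model_category = category C
  for C :: "('o, 'a) cat" (structure) +
  fixes W Fib Cof :: "'a set"
  assumes finite_limits: "has_finite_limits C"
    and finite_colimits: "has_finite_colimits C"
    and W_wide: "wide_subcategory C W"
    and Fib_wide: "wide_subcategory C Fib"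
    and Cof_wide: "wide_subcategory C Cof"
    and W_cancel_left: "f \<in> hom C X Y \<Longrightarrow> g \<in> hom C Y Z \<Longrightarrow> g \<in> W \<Longrightarrow> g \<cdot> f \<in> W \<Longrightarrow> f \<in> W"
    and W_cancel_right: "f \<in> hom C X Y \<Longrightarrow> g \<in> hom C Y Z \<Longrightarrow> f \<in> W \<Longrightarrow> g \<cdot> f \<in> W \<Longrightarrow> g \<in> W"
    and W_retract: "is_retract C f g \<Longrightarrow> g \<in> W \<Longrightarrow> f \<in> W"
    and Fib_retract: "is_retract C f g \<Longrightarrow> g \<in> Fib \<Longrightarrow> f \<in> Fib"
    and Cof_retract: "is_retract C f g \<Longrightarrow> g \<in> Cof \<Longrightarrow> f \<in> Cof"
    and lift_Cof_triv_Fib: "i \<in> Cof \<Longrightarrow> p \<in> Fib \<inter> W \<Longrightarrow> has_lifting C i p"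
    and lift_triv_Cof_Fib: "i \<in> Cof \<inter> W \<Longrightarrow> p \<in> Fib \<Longrightarrow> has_lifting C i p"
    and factor_Cof_triv_Fib: "f \<in> Arr C \<Longrightarrow>
      \<exists>i\<in>Cof. \<exists>p\<in>Fib \<inter> W. Dom C i = Dom C f \<and> Cod C p = Cod C f \<and> Cod C i = Dom C p \<and> f = p \<cdot> i"
    and factor_triv_Cof_Fib: "f \<in> Arr C \<Longrightarrow>
      \<exists>i\<in>Cof \<inter> W. \<exists>p\<in>Fib. Dom C i = Dom C f \<and> Cod C p = Cod C f \<and> Cod C i = Dom C p \<and> f = p \<cdot> i"

definition cofibrant :: "('o, 'a) cat \<Rightarrow> 'a set \<Rightarrow> 'o \<Rightarrow> bool" where
  "cofibrant C Cof X \<longleftrightarrow> X \<in> Obj C \<and> (\<exists>I. is_initial C I \<and> (\<exists>f \<in> hom C I X. f \<in> Cof))"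

definition fibrant :: "('o, 'a) cat \<Rightarrow> 'a set \<Rightarrow> 'o \<Rightarrow> bool" where
  "fibrant C Fib X \<longleftrightarrow> X \<in> Obj C \<and> (\<exists>T. is_terminal C T \<and> (\<exists>f \<in> hom C X T. f \<in> Fib))"

definition cof_cat :: "('o, 'a) cat \<Rightarrow> 'a set \<Rightarrow> ('o, 'a) cat" where
  "cof_cat C Cof = full_subcat C (cofibrant C Cof)"

definition fibcof_cat :: "('o, 'a) cat \<Rightarrow> 'a set \<Rightarrow> 'a set \<Rightarrow> ('o, 'a) cat" where
  "fibcof_cat C Fib Cof = full_subcat C (\<lambda>X. fibrant C Fib X \<and> cofibrant C Cof X)"

definition cofibrant_replacement :: "('o, 'a) cat \<Rightarrow> 'a set \<Rightarrow> 'a set \<Rightarrow>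
    ('o, 'a, 'o, 'a) cfunctor \<Rightarrow> ('o \<Rightarrow> 'a) \<Rightarrow> bool" where
  "cofibrant_replacement C W Cof Q q \<longleftrightarrow> is_functor C C Q
     \<and> (\<forall>w\<in>W. amap Q w \<in> W)
     \<and> (\<forall>X\<in>Obj C. cofibrant C Cof (omap Q X))
     \<and> is_nat_trans C C Q id_functor q
     \<and> (\<forall>X\<in>Obj C. q X \<in> W)"

definition fibrant_replacement :: "('o, 'a) cat \<Rightarrow> 'a set \<Rightarrow> 'a set \<Rightarrow> 'a set \<Rightarrow>
    ('o, 'a, 'o, 'a) cfunctor \<Rightarrow> ('o \<Rightarrow> 'a) \<Rightarrow> bool" where
  "fibrant_replacement C W Fib Cof R r \<longleftrightarrow> is_functor (cof_cat C Cof) (cof_cat C Cof) R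
     \<and> (\<forall>w \<in> W \<inter> Arr (cof_cat C Cof). amap R w \<in> W)
     \<and> (\<forall>X \<in> Obj (cof_cat C Cof). omap R X \<in> Obj (fibcof_cat C Fib Cof))
     \<and> is_nat_trans (cof_cat C Cof) (cof_cat C Cof) id_functor R r
     \<and> (\<forall>X \<in> Obj (cof_cat C Cof). r X \<in> W)"

definition homotopical :: "('o, 'a) cat \<Rightarrow> ('o, 'a, 'p, 'b) cfunctor \<Rightarrow> ('a \<times> 'a) set" where
  "homotopical D \<gamma> = {(f, g). f \<in> Arr D \<and> g \<in> Arr D \<and> Dom D f = Dom D g \<and> Cod D f = Cod D g
     \<and> amap \<gamma> f = amap \<gamma> g}"

text \<open>For a congruence \<open>s\<close> relating only parallel arrows; \<open>Dom\<close> and \<open>Cod\<close> take the common value.\<close>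

definition quotient_cat :: "('o, 'a) cat \<Rightarrow> ('a \<times> 'a) set \<Rightarrow> ('o, 'a set) cat" where
  "quotient_cat D s = \<lparr>Obj = Obj D, Arr = Arr D // s,
     Dom = (\<lambda>K. the_elem (Dom D ` K)), Cod = (\<lambda>K. the_elem (Cod D ` K)),
     Ide = (\<lambda>X. s `` {Ide D X}),
     Cmp = (\<lambda>K' K. \<Union>g\<in>K'. \<Union>f\<in>K. s `` {g \<cdot>\<^bsub>D\<^esub> f})\<rparr>"

text \<open>
  Given \<open>P\<close> from the objects of \<open>C\<close> to those of \<open>H\<close>, the category with the objects of \<open>C\<close> and
  with \<open>H\<close>-arrows \<open>P X \<rightarrow> P Y\<close> as arrows \<open>X \<rightarrow> Y\<close>. Since \<open>P\<close> need not be injective, an arrow is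
  a triple recording also its endpoints.
\<close>

definition pullback_cat ::
    "('o, 'a) cat \<Rightarrow> ('o \<Rightarrow> 'p) \<Rightarrow> ('p, 'b) cat \<Rightarrow> ('o, 'o \<times> 'b \<times> 'o) cat" where
  "pullback_cat C P H = \<lparr>Obj = Obj C,
     Arr = {(X, k, Y). X \<in> Obj C \<and> Y \<in> Obj C \<and> k \<in> hom H (P X) (P Y)},
     Dom = (\<lambda>(X, k, Y). X), Cod = (\<lambda>(X, k, Y). Y),
     Ide = (\<lambda>X. (X, Ide H (P X), X)),
     Cmp = (\<lambda>(_, l, Z) (X, k, _). (X, l \<cdot>\<^bsub>H\<^esub> k, Z))\<rparr>"

definition homotopy_cat :: "('o, 'a) cat \<Rightarrow> 'a set \<Rightarrow> 'a set \<Rightarrow> ('o, 'a, 'o, 'a) cfunctor \<Rightarrow>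
    ('o, 'a, 'o, 'a) cfunctor \<Rightarrow> ('o, 'a, 'p, 'b) cfunctor \<Rightarrow> ('o, 'o \<times> 'a set \<times> 'o) cat" where
  "homotopy_cat C Fib Cof Q R \<gamma>0 =
     (let D = fibcof_cat C Fib Cof in
      pullback_cat C (omap (comp_functor R Q)) (quotient_cat D (homotopical D \<gamma>0)))"

definition homotopy_functor :: "('o, 'a) cat \<Rightarrow> 'a set \<Rightarrow> 'a set \<Rightarrow> ('o, 'a, 'o, 'a) cfunctor \<Rightarrow>
    ('o, 'a, 'o, 'a) cfunctor \<Rightarrow> ('o, 'a, 'p, 'b) cfunctor \<Rightarrow>
    ('o, 'a, 'o, 'o \<times> 'a set \<times> 'o) cfunctor" where
  "homotopy_functor C Fib Cof Q R \<gamma>0 = \<lparr>omap = (\<lambda>X. X),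
     amap = (\<lambda>f. (Dom C f,
       homotopical (fibcof_cat C Fib Cof) \<gamma>0 `` {amap (comp_functor R Q) f}, Cod C f))\<rparr>"

end

theory Submission
  imports Defs
begin

text \<open>
  Write \<open>D\<close> for the category of fibrant-cofibrant objects, \<open>[k]\<close> for the class of an arrow \<open>k\<close> of
  \<open>D\<close>, \<open>H\<close> for the constructed category and \<open>L\<close> for the functor into it.

  The homotopy theory enters only in showing that \<open>L\<close> inverts weak equivalences, that is, that the
  inverse of \<open>\<gamma>\<^sub>0 w\<close> is represented by an arrow of \<open>D\<close> (\<open>quotient_inverts\<close>). Factor a weak
  equivalence \<open>w\<close> of \<open>D\<close> as a trivial cofibration followed by a trivial fibration; the
  middle object lies in \<open>D\<close> again. The first has a retraction and the second a section, by lifting.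
  Since \<open>\<gamma>\<^sub>0\<close> already inverts both factors, a one-sided inverse in \<open>D\<close> becomes two-sided under
  \<open>\<gamma>\<^sub>0\<close>, hence in the quotient.

  The rest is formal. A functor \<open>F\<close> that inverts weak equivalences has a natural
  isomorphism \<open>\<sigma>\<^sub>X = F(r\<^sub>Q\<^sub>X) F(q\<^sub>X)\<inverse>\<close> from \<open>F X\<close> to \<open>F(RQX)\<close>, the \<open>comparison\<close>. So \<open>F\<close> is determined by
  its restriction to \<open>D\<close>, which factors through \<open>\<gamma>\<^sub>0\<close> and therefore takes equal values on homotopic
  arrows: the factorization of \<open>F\<close> through \<open>L\<close> sends the arrow \<open>(X, [k], Y)\<close> to
  \<open>\<sigma>\<^sub>Y\<inverse> F(k) \<sigma>\<^sub>X\<close> (\<open>factorization_exists\<close>).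

  For uniqueness, the arrow \<open>(X, [k], Y)\<close> must itself be \<open>\<sigma>\<^sub>Y\<inverse> L(k) \<sigma>\<^sub>X\<close> in \<open>H\<close>
  (\<open>comparison_conjugates\<close>). This is the one delicate point, because
  \<open>L(k)\<close> is the class of \<open>RQk\<close> and not of \<open>k\<close>. Both are conjugate along the arrows
  \<open>r\<^sub>A : A \<rightarrow> RA\<close> and \<open>R(q\<^sub>A) : RQA \<rightarrow> RA\<close>, natural in \<open>A\<close>; that this is the same conjugation as along
  the comparison of \<open>L\<close> comes down to \<open>[r\<^sub>R\<^sub>A] = [R(r\<^sub>A)]\<close> and \<open>[R(q\<^sub>Q\<^sub>X)] = [RQ(q\<^sub>X)]\<close>
  (\<open>r_R_eq_R_r\<close>, \<open>q_Q_eq_Q_q\<close>).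
\<close>

section \<open>Isomorphisms and functors\<close>

lemma homI: "f \<in> Arr C \<Longrightarrow> f \<in> hom C (Dom C f) (Cod C f)"
  by (simp add: hom_def)

lemma homD:
  assumes "f \<in> hom C X Y"
  shows "f \<in> Arr C" "Dom C f = X" "Cod C f = Y"
  using assms by (auto simp: hom_def)

context category
begin

lemma hom_objs:
  assumes "f \<in> hom C X Y"
  shows "X \<in> Obj C" "Y \<in> Obj C"
  using assms dom_in cod_in by (auto simp: hom_def)

lemma is_isoI:
  assumes "f \<in> hom C X Y" "g \<in> hom C Y X" "g \<cdot> f = Ide C X" "f \<cdot> g = Ide C Y"
  shows "is_iso C f"
  using assms unfolding is_iso_def by (auto simp: hom_def)

lemma is_isoE:
  assumes "is_iso C f" "f \<in> hom C X Y"
  obtains g where "g \<in> hom C Y X" "g \<cdot> f = Ide C X" "f \<cdot> g = Ide C Y"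
  using assms unfolding is_iso_def by (auto simp: hom_def)

lemma iso_cancel_left:
  assumes "is_iso C a" "a \<in> hom C Y Z" "f \<in> hom C X Y" "g \<in> hom C X Y" "a \<cdot> f = a \<cdot> g"
  shows "f = g"
proof -
  obtain b where b: "b \<in> hom C Z Y" "b \<cdot> a = Ide C Y"
    using is_isoE assms(1,2) by metis
  have "f = (b \<cdot> a) \<cdot> f" using b ide_left assms by simp
  also have "\<dots> = (b \<cdot> a) \<cdot> g"
    using cmp_assoc[OF assms(3,2) b(1)] cmp_assoc[OF assms(4,2) b(1)] assms(5) by simp
  also have "\<dots> = g" using b ide_left assms by simp
  finally show ?thesis .
qed

lemma iso_cancel_right:
  assumes "is_iso C a" "a \<in> hom C X Y" "f \<in> hom C Y Z" "g \<in> hom C Y Z" "f \<cdot> a = g \<cdot> a"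
  shows "f = g"
proof -
  obtain b where b: "b \<in> hom C Y X" "a \<cdot> b = Ide C Y"
    using is_isoE assms(1,2) by metis
  have "f = f \<cdot> (a \<cdot> b)" using b ide_right assms by simp
  also have "\<dots> = g \<cdot> (a \<cdot> b)"
    using cmp_assoc[OF b(1) assms(2,3)] cmp_assoc[OF b(1) assms(2,4)] assms(5) by simp
  also have "\<dots> = g" using b ide_right assms by simp
  finally show ?thesis .
qed

lemma left_inverse_of_iso:
  assumes "is_iso C f" "f \<in> hom C X Y" "g \<in> hom C Y X" "g \<cdot> f = Ide C X"
  shows "f \<cdot> g = Ide C Y"
proof (rule iso_cancel_right[OF assms(1,2)])
  show "f \<cdot> g \<in> hom C Y Y" "Ide C Y \<in> hom C Y Y"
    using assms cmp_in ide_in hom_objs by blast+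
  show "f \<cdot> g \<cdot> f = Ide C Y \<cdot> f"
    using cmp_assoc[OF assms(2,3,2)] ide_left[OF assms(2)] ide_right[OF assms(2)] assms(4) by simp
qed

lemma right_inverse_of_iso:
  assumes "is_iso C f" "f \<in> hom C X Y" "g \<in> hom C Y X" "f \<cdot> g = Ide C Y"
  shows "g \<cdot> f = Ide C X"
proof (rule iso_cancel_left[OF assms(1,2)])
  show "g \<cdot> f \<in> hom C X X" "Ide C X \<in> hom C X X"
    using assms cmp_in ide_in hom_objs by blast+
  show "f \<cdot> (g \<cdot> f) = f \<cdot> Ide C X"
    using cmp_assoc[OF assms(2,3,2)] ide_left[OF assms(2)] ide_right[OF assms(2)] assms(4) by simp
qed

lemma iso_cmp:
  assumes "is_iso C f" "f \<in> hom C X Y" "is_iso C g" "g \<in> hom C Y Z"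
  shows "is_iso C (g \<cdot> f)"
proof -
  obtain f' where f': "f' \<in> hom C Y X" "f' \<cdot> f = Ide C X" "f \<cdot> f' = Ide C Y"
    using is_isoE assms(1,2) by metis
  obtain g' where g': "g' \<in> hom C Z Y" "g' \<cdot> g = Ide C Y" "g \<cdot> g' = Ide C Z"
    using is_isoE assms(3,4) by metis
  have gf: "g \<cdot> f \<in> hom C X Z" and fg: "f' \<cdot> g' \<in> hom C Z X"
    using assms f' g' cmp_in by blast+
  have "g' \<cdot> (g \<cdot> f) = f"
    using cmp_assoc[OF assms(2,4) g'(1)] g' ide_left[OF assms(2)] by simp
  then have 1: "(f' \<cdot> g') \<cdot> (g \<cdot> f) = Ide C X"
    using cmp_assoc[OF gf g'(1) f'(1)] f' by simp
  have "f \<cdot> (f' \<cdot> g') = g'"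
    using cmp_assoc[OF g'(1) f'(1) assms(2)] f' ide_left[OF g'(1)] by simp
  then have "(g \<cdot> f) \<cdot> (f' \<cdot> g') = Ide C Z"
    using cmp_assoc[OF fg assms(2,4)] g' by simp
  then show ?thesis using is_isoI gf fg 1 by blast
qed

end

definition inverse_arr :: "('o, 'a) cat \<Rightarrow> 'a \<Rightarrow> 'a" where
  "inverse_arr C f = (SOME g. g \<in> hom C (Cod C f) (Dom C f)
     \<and> g \<cdot>\<^bsub>C\<^esub> f = Ide C (Dom C f) \<and> f \<cdot>\<^bsub>C\<^esub> g = Ide C (Cod C f))"

context category
begin

lemma inverse_arr:
  assumes "is_iso C f" "f \<in> hom C X Y"
  shows "inverse_arr C f \<in> hom C Y X"
    and "inverse_arr C f \<cdot> f = Ide C X"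
    and "f \<cdot> inverse_arr C f = Ide C Y"
proof -
  have "\<exists>g. g \<in> hom C (Cod C f) (Dom C f)
     \<and> g \<cdot> f = Ide C (Dom C f) \<and> f \<cdot> g = Ide C (Cod C f)"
    using assms(1) unfolding is_iso_def by blast
  then have "inverse_arr C f \<in> hom C (Cod C f) (Dom C f)
     \<and> inverse_arr C f \<cdot> f = Ide C (Dom C f) \<and> f \<cdot> inverse_arr C f = Ide C (Cod C f)"
    unfolding inverse_arr_def by (rule someI_ex)
  then show "inverse_arr C f \<in> hom C Y X" "inverse_arr C f \<cdot> f = Ide C X"
    "f \<cdot> inverse_arr C f = Ide C Y"
    using assms(2) by (auto simp: hom_def)
qed

lemma iso_inverse_arr:
  assumes "is_iso C f" "f \<in> hom C X Y"
  shows "is_iso C (inverse_arr C f)"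
  using inverse_arr[OF assms] assms(2) by (blast intro: is_isoI)

end

lemma functor_cats:
  assumes "is_functor C D F"
  shows "category C" "category D"
  using assms by (auto simp: is_functor_def)

lemma functor_obj:
  "is_functor C D F \<Longrightarrow> X \<in> Obj C \<Longrightarrow> omap F X \<in> Obj D"
  by (auto simp: is_functor_def)

lemma functor_hom:
  "is_functor C D F \<Longrightarrow> f \<in> hom C X Y \<Longrightarrow> amap F f \<in> hom D (omap F X) (omap F Y)"
  by (auto simp: is_functor_def hom_def)

lemma functor_ide:
  "is_functor C D F \<Longrightarrow> X \<in> Obj C \<Longrightarrow> amap F (Ide C X) = Ide D (omap F X)"
  by (auto simp: is_functor_def)

lemma functor_cmp:
  "is_functor C D F \<Longrightarrow> f \<in> hom C X Y \<Longrightarrow> g \<in> hom C Y Z \<Longrightarrow>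
    amap F (g \<cdot>\<^bsub>C\<^esub> f) = amap F g \<cdot>\<^bsub>D\<^esub> amap F f"
  by (auto simp: is_functor_def hom_def)

lemma is_functorI:
  assumes "category C" "category D"
    and "\<And>X. X \<in> Obj C \<Longrightarrow> omap F X \<in> Obj D"
    and "\<And>f X Y. f \<in> hom C X Y \<Longrightarrow> amap F f \<in> hom D (omap F X) (omap F Y)"
    and "\<And>X. X \<in> Obj C \<Longrightarrow> amap F (Ide C X) = Ide D (omap F X)"
    and "\<And>f g X Y Z. f \<in> hom C X Y \<Longrightarrow> g \<in> hom C Y Z \<Longrightarrow>
      amap F (g \<cdot>\<^bsub>C\<^esub> f) = amap F g \<cdot>\<^bsub>D\<^esub> amap F f"
  shows "is_functor C D F"
  unfolding is_functor_def
proof (intro conjI ballI impI)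
  fix f g assume "f \<in> Arr C" "g \<in> Arr C" "Cod C f = Dom C g"
  then show "amap F (g \<cdot>\<^bsub>C\<^esub> f) = amap F g \<cdot>\<^bsub>D\<^esub> amap F f"
    using assms(6)[of f "Dom C f" "Cod C f" g "Cod C g"] by (simp add: hom_def)
qed (use assms in \<open>auto dest: homI\<close>)

lemma functor_eq_obj: "functor_eq C F G \<Longrightarrow> X \<in> Obj C \<Longrightarrow> omap F X = omap G X"
  by (simp add: functor_eq_def)

lemma functor_eq_arr: "functor_eq C F G \<Longrightarrow> f \<in> hom C X Y \<Longrightarrow> amap F f = amap G f"
  by (auto simp: functor_eq_def dest: homD)

lemma comp_functor_simps [simp]:
  "omap (comp_functor G F) X = omap G (omap F X)"
  "amap (comp_functor G F) f = amap G (amap F f)"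
  by (simp_all add: comp_functor_def)

lemma comp_functor:
  assumes F: "is_functor C D F" and G: "is_functor D E G"
  shows "is_functor C E (comp_functor G F)"
proof (rule is_functorI)
  show "category C" "category E" using functor_cats F G by blast+
next
  fix f g X Y Z assume fg: "f \<in> hom C X Y" "g \<in> hom C Y Z"
  show "amap (comp_functor G F) (g \<cdot>\<^bsub>C\<^esub> f)
      = amap (comp_functor G F) g \<cdot>\<^bsub>E\<^esub> amap (comp_functor G F) f"
    using functor_cmp[OF F fg] functor_cmp[OF G functor_hom[OF F fg(1)] functor_hom[OF F fg(2)]]
    by simp
qed (simp_all add: functor_obj[OF F] functor_obj[OF G] functor_ide[OF F] functor_ide[OF G]
      functor_hom[OF F] functor_hom[OF G])

lemma nat_trans_hom:
  "is_nat_trans C D F G \<eta> \<Longrightarrow> X \<in> Obj C \<Longrightarrow> \<eta> X \<in> hom D (omap F X) (omap G X)"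
  by (simp add: is_nat_trans_def)

lemma nat_trans_natural:
  "is_nat_trans C D F G \<eta> \<Longrightarrow> f \<in> hom C X Y \<Longrightarrow>
    \<eta> Y \<cdot>\<^bsub>D\<^esub> amap F f = amap G f \<cdot>\<^bsub>D\<^esub> \<eta> X"
  by (auto simp: is_nat_trans_def hom_def)

section \<open>Full subcategories, quotients and pullbacks of categories\<close>

lemma full_subcat_simps [simp]:
  "Obj (full_subcat C P) = {X \<in> Obj C. P X}"
  "Arr (full_subcat C P) = {f \<in> Arr C. P (Dom C f) \<and> P (Cod C f)}"
  "Dom (full_subcat C P) = Dom C" "Cod (full_subcat C P) = Cod C"
  "Ide (full_subcat C P) = Ide C" "Cmp (full_subcat C P) = Cmp C"
  by (simp_all add: full_subcat_def)

lemma hom_full_subcat: "f \<in> hom (full_subcat C P) X Y \<longleftrightarrow> f \<in> hom C X Y \<and> P X \<and> P Y"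
  by (auto simp: hom_def)

lemma (in category) category_full_subcat: "category (full_subcat C P)"
  by unfold_locales
    (auto simp: hom_full_subcat dom_in cod_in ide_in ide_left ide_right cmp_in cmp_assoc)

lemma functor_full_subcat:
  assumes F: "is_functor C D F"
  shows "is_functor (full_subcat C P) D F"
  by (rule is_functorI)
    (auto simp: hom_full_subcat category.category_full_subcat functor_cats[OF F] functor_ide[OF F]
      functor_obj[OF F] functor_hom[OF F] functor_cmp[OF F])

abbreviation quotient_functor :: "('o, 'a) cat \<Rightarrow> ('o, 'a, 'p, 'b) cfunctor \<Rightarrow>
    ('o, 'a, 'o, 'a set) cfunctor" where
  "quotient_functor D \<gamma> \<equiv> \<lparr>omap = \<lambda>X. X, amap = \<lambda>f. homotopical D \<gamma> `` {f}\<rparr>"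

lemma class_eq_iff:
  assumes "f \<in> hom D X Y" "g \<in> hom D X Y"
  shows "homotopical D \<gamma> `` {f} = homotopical D \<gamma> `` {g} \<longleftrightarrow> amap \<gamma> f = amap \<gamma> g"
  using assms by (fastforce simp: homotopical_def hom_def)

lemma homotopical_iff:
  assumes "f \<in> hom D X Y"
  shows "(f, g) \<in> homotopical D \<gamma> \<longleftrightarrow> g \<in> hom D X Y \<and> amap \<gamma> g = amap \<gamma> f"
  using assms by (auto simp: homotopical_def hom_def)

lemma hom_quotient_cat:
  "hom (quotient_cat D (homotopical D \<gamma>)) X Y = (\<lambda>f. homotopical D \<gamma> `` {f}) ` hom D X Y"
proof -
  have "the_elem (Dom D ` (homotopical D \<gamma> `` {f})) = Dom D f"
    "the_elem (Cod D ` (homotopical D \<gamma> `` {f})) = Cod D f" if "f \<in> Arr D" for f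
  proof -
    have "Dom D ` (homotopical D \<gamma> `` {f}) = {Dom D f}"
      "Cod D ` (homotopical D \<gamma> `` {f}) = {Cod D f}"
      using that by (auto simp: homotopical_def image_iff)
    then show "the_elem (Dom D ` (homotopical D \<gamma> `` {f})) = Dom D f"
      "the_elem (Cod D ` (homotopical D \<gamma> `` {f})) = Cod D f" by simp_all
  qed
  then show ?thesis
    by (auto simp: hom_def quotient_cat_def quotient_def)
qed

lemma quotient_functor_cmp:
  assumes \<gamma>: "is_functor D E \<gamma>" and f: "f \<in> hom D X Y" and g: "g \<in> hom D Y Z"
  shows "homotopical D \<gamma> `` {g} \<cdot>\<^bsub>quotient_cat D (homotopical D \<gamma>)\<^esub> homotopical D \<gamma> `` {f}
    = homotopical D \<gamma> `` {g \<cdot>\<^bsub>D\<^esub> f}"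
proof -
  interpret D: category D by (rule functor_cats(1)[OF \<gamma>])
  let ?F = "homotopical D \<gamma> `` {f}" and ?G = "homotopical D \<gamma> `` {g}"
    and ?GF = "homotopical D \<gamma> `` {g \<cdot>\<^bsub>D\<^esub> f}"
  have eq: "homotopical D \<gamma> `` {g' \<cdot>\<^bsub>D\<^esub> f'} = ?GF" if "g' \<in> ?G" "f' \<in> ?F" for f' g'
  proof -
    have *: "f' \<in> hom D X Y" "g' \<in> hom D Y Z" "amap \<gamma> f' = amap \<gamma> f" "amap \<gamma> g' = amap \<gamma> g"
      using that by (simp_all add: homotopical_iff[OF f] homotopical_iff[OF g])
    have "amap \<gamma> (g' \<cdot>\<^bsub>D\<^esub> f') = amap \<gamma> (g \<cdot>\<^bsub>D\<^esub> f)"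
      using functor_cmp[OF \<gamma> *(1,2)] functor_cmp[OF \<gamma> f g] * by simp
    then show ?thesis
      by (simp add: class_eq_iff[OF D.cmp_in[OF *(1,2)] D.cmp_in[OF f g]])
  qed
  have "g \<in> ?G" "f \<in> ?F"
    using f g by (simp_all add: homotopical_iff[OF f] homotopical_iff[OF g])
  have "(\<Union>g'\<in>?G. \<Union>f'\<in>?F. homotopical D \<gamma> `` {g' \<cdot>\<^bsub>D\<^esub> f'}) = (\<Union>g'\<in>?G. \<Union>f'\<in>?F. ?GF)"
    by (intro SUP_cong refl eq)
  also have "\<dots> = ?GF" using \<open>g \<in> ?G\<close> \<open>f \<in> ?F\<close> by auto
  finally show ?thesis by (simp add: quotient_cat_def)
qed

lemma quotient_cat_simps [simp]:
  "Obj (quotient_cat D s) = Obj D" "Ide (quotient_cat D s) X = s `` {Ide D X}"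
  by (simp_all add: quotient_cat_def)

lemma category_quotient_cat:
  assumes \<gamma>: "is_functor D E \<gamma>"
  shows "category (quotient_cat D (homotopical D \<gamma>))"
proof -
  interpret D: category D by (rule functor_cats(1)[OF \<gamma>])
  let ?H = "quotient_cat D (homotopical D \<gamma>)" and ?cls = "\<lambda>f. homotopical D \<gamma> `` {f}"
  note cmp = quotient_functor_cmp[OF \<gamma>]
  show ?thesis
  proof
    fix K assume "K \<in> Arr ?H"
    then have "K \<in> hom ?H (Dom ?H K) (Cod ?H K)" by (rule homI)
    then show "Dom ?H K \<in> Obj ?H" "Cod ?H K \<in> Obj ?H"
      by (auto simp: hom_quotient_cat dest: D.hom_objs)
  next
    fix X assume "X \<in> Obj ?H"
    then show "Ide ?H X \<in> hom ?H X X" by (simp add: hom_quotient_cat D.ide_in)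
  next
    fix f X Y assume "f \<in> hom ?H X Y"
    then obtain f' where f: "f = ?cls f'" "f' \<in> hom D X Y" by (auto simp: hom_quotient_cat)
    have XY: "Ide D X \<in> hom D X X" "Ide D Y \<in> hom D Y Y" using f D.hom_objs D.ide_in by blast+
    show "Ide ?H Y \<cdot>\<^bsub>?H\<^esub> f = f" "f \<cdot>\<^bsub>?H\<^esub> Ide ?H X = f"
      using cmp[OF f(2) XY(2)] cmp[OF XY(1) f(2)] f D.ide_left D.ide_right by simp_all
  next
    fix f g X Y Z assume "f \<in> hom ?H X Y" "g \<in> hom ?H Y Z"
    then obtain f' g' where "f = ?cls f'" "f' \<in> hom D X Y" "g = ?cls g'" "g' \<in> hom D Y Z"
      by (auto simp: hom_quotient_cat)
    then show "g \<cdot>\<^bsub>?H\<^esub> f \<in> hom ?H X Z" using D.cmp_in by (simp add: cmp hom_quotient_cat)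
  next
    fix f g h X Y Z V
    assume "f \<in> hom ?H X Y" "g \<in> hom ?H Y Z" "h \<in> hom ?H Z V"
    then obtain f' g' h' where *: "f = ?cls f'" "f' \<in> hom D X Y" "g = ?cls g'" "g' \<in> hom D Y Z"
      "h = ?cls h'" "h' \<in> hom D Z V"
      by (auto simp: hom_quotient_cat)
    have "g' \<cdot>\<^bsub>D\<^esub> f' \<in> hom D X Z" "h' \<cdot>\<^bsub>D\<^esub> g' \<in> hom D Y V" using * D.cmp_in by blast+
    then show "(h \<cdot>\<^bsub>?H\<^esub> g) \<cdot>\<^bsub>?H\<^esub> f = h \<cdot>\<^bsub>?H\<^esub> (g \<cdot>\<^bsub>?H\<^esub> f)"
      using * D.cmp_assoc by (simp add: cmp)
  qed
qed

lemma is_functor_quotient_functor: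
  assumes \<gamma>: "is_functor D E \<gamma>"
  shows "is_functor D (quotient_cat D (homotopical D \<gamma>)) (quotient_functor D \<gamma>)"
  by (rule is_functorI)
    (auto simp: category_quotient_cat[OF \<gamma>] functor_cats[OF \<gamma>] hom_quotient_cat
      quotient_functor_cmp[OF \<gamma>])

lemma quotient_iso:
  assumes \<gamma>: "is_functor D E \<gamma>"
    and "f \<in> hom D X Y" "g \<in> hom D Y X"
    and "amap \<gamma> (g \<cdot>\<^bsub>D\<^esub> f) = amap \<gamma> (Ide D X)" "amap \<gamma> (f \<cdot>\<^bsub>D\<^esub> g) = amap \<gamma> (Ide D Y)"
  shows "is_iso (quotient_cat D (homotopical D \<gamma>)) (homotopical D \<gamma> `` {f})"
proof -
  interpret D: category D by (rule functor_cats(1)[OF \<gamma>])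
  interpret H: category "quotient_cat D (homotopical D \<gamma>)" by (rule category_quotient_cat[OF \<gamma>])
  note hom = functor_hom[OF is_functor_quotient_functor[OF \<gamma>], simplified]
  have ide: "Ide D X \<in> hom D X X" "Ide D Y \<in> hom D Y Y"
    using assms D.ide_in D.hom_objs by blast+
  show ?thesis
  proof (rule H.is_isoI)
    show "homotopical D \<gamma> `` {f} \<in> hom (quotient_cat D (homotopical D \<gamma>)) X Y"
      "homotopical D \<gamma> `` {g} \<in> hom (quotient_cat D (homotopical D \<gamma>)) Y X"
      using hom assms by blast+
  qed (use assms in \<open>auto simp: quotient_functor_cmp[OF \<gamma>] class_eq_iff[OF D.cmp_in ide(1)]
      class_eq_iff[OF D.cmp_in ide(2)]\<close>)
qed

lemma pullback_cat_simps [simp]: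
  "Obj (pullback_cat C P H) = Obj C"
  "Ide (pullback_cat C P H) X = (X, Ide H (P X), X)"
  "(Y', l, Z) \<cdot>\<^bsub>pullback_cat C P H\<^esub> (X, k, Y) = (X, l \<cdot>\<^bsub>H\<^esub> k, Z)"
  by (simp_all add: pullback_cat_def)

lemma hom_pullback_cat:
  "hom (pullback_cat C P H) X Y =
    {(X, k, Y) | k. X \<in> Obj C \<and> Y \<in> Obj C \<and> k \<in> hom H (P X) (P Y)}"
  by (auto simp: hom_def pullback_cat_def)

lemma category_pullback_cat:
  assumes "category H" "\<And>X. X \<in> Obj C \<Longrightarrow> P X \<in> Obj H"
  shows "category (pullback_cat C P H)"
proof -
  interpret H: category H by fact
  let ?B = "pullback_cat C P H"
  show ?thesis
  proof
    fix K assume "K \<in> Arr ?B"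
    then have "K \<in> hom ?B (Dom ?B K) (Cod ?B K)" by (rule homI)
    then show "Dom ?B K \<in> Obj ?B" "Cod ?B K \<in> Obj ?B"
      by (auto simp: hom_pullback_cat)
  qed (auto simp: hom_pullback_cat assms H.ide_in H.ide_left H.ide_right H.cmp_in H.cmp_assoc)
qed

lemma pullback_iso:
  assumes "category H" "\<And>X. X \<in> Obj C \<Longrightarrow> P X \<in> Obj H"
    and "X \<in> Obj C" "Y \<in> Obj C" "k \<in> hom H (P X) (P Y)" "is_iso H k"
  shows "is_iso (pullback_cat C P H) (X, k, Y)"
proof -
  interpret H: category H by fact
  interpret B: category "pullback_cat C P H" using category_pullback_cat assms(1,2) .
  obtain l where "l \<in> hom H (P Y) (P X)" "l \<cdot>\<^bsub>H\<^esub> k = Ide H (P X)" "k \<cdot>\<^bsub>H\<^esub> l = Ide H (P Y)"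
    using H.is_isoE assms(5,6) by metis
  then show ?thesis
    using assms B.is_isoI[of "(X, k, Y)" X Y "(Y, l, X)"] by (simp add: hom_pullback_cat)
qed

section \<open>Weak equivalences between fibrant-cofibrant objects\<close>

context model_category
begin

abbreviation D where "D \<equiv> fibcof_cat C Fib Cof"
abbreviation Cc where "Cc \<equiv> cof_cat C Cof"

lemma obj_D_iff: "X \<in> Obj D \<longleftrightarrow> fibrant C Fib X \<and> cofibrant C Cof X"
  by (auto simp: fibcof_cat_def fibrant_def)

lemma obj_Cc_iff: "X \<in> Obj Cc \<longleftrightarrow> cofibrant C Cof X"
  by (auto simp: cof_cat_def cofibrant_def)

lemma hom_D_iff: "f \<in> hom D X Y \<longleftrightarrow> f \<in> hom C X Y \<and> X \<in> Obj D \<and> Y \<in> Obj D"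
  by (simp add: obj_D_iff) (auto simp: fibcof_cat_def hom_full_subcat)

lemma hom_Cc_iff: "f \<in> hom Cc X Y \<longleftrightarrow> f \<in> hom C X Y \<and> X \<in> Obj Cc \<and> Y \<in> Obj Cc"
  by (simp add: obj_Cc_iff) (auto simp: cof_cat_def hom_full_subcat)

lemma obj_D_imp_Cc: "X \<in> Obj D \<Longrightarrow> X \<in> Obj Cc"
  by (simp add: obj_D_iff obj_Cc_iff)

lemma fibcof_cof_cat_simps [simp]:
  "Cmp D = Cmp C" "Ide D = Ide C" "Cmp Cc = Cmp C" "Ide Cc = Ide C"
  by (simp_all add: fibcof_cat_def cof_cat_def)

lemma category_D: "category D" and category_Cc: "category Cc"
  by (simp_all add: fibcof_cat_def cof_cat_def category_full_subcat)

lemma W_D_iff: "f \<in> hom D X Y \<Longrightarrow> f \<in> W \<inter> Arr D \<longleftrightarrow> f \<in> W"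
  by (auto dest: homD)

text \<open>
  Lift the identity of \<open>X\<close> along \<open>i\<close> against the fibration from \<open>X\<close> to a terminal object; the
  square commutes because its target is terminal.
\<close>

lemma triv_cof_retraction:
  assumes "i \<in> Cof" "i \<in> W" "i \<in> hom C X Z" "fibrant C Fib X"
  obtains s where "s \<in> hom C Z X" "s \<cdot> i = Ide C X"
proof -
  obtain T f where T: "is_terminal C T" and f: "f \<in> hom C X T" "f \<in> Fib"
    using assms by (auto simp: fibrant_def)
  have "Z \<in> Obj C" using assms hom_objs by blast
  then obtain v where v: "v \<in> hom C Z T"
    using T unfolding is_terminal_def by blast
  have X: "X \<in> Obj C" using assms hom_objs by blast
  have "\<exists>!h. h \<in> hom C X T" using T X by (simp add: is_terminal_def)
  then have "f \<cdot> Ide C X = v \<cdot> i"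
    using cmp_in[OF ide_in[OF X] f(1)] cmp_in[OF assms(3) v] by blast
  moreover have "Ide C X \<in> hom C X X" using X by (rule ide_in)
  moreover have "has_lifting C i f" using lift_triv_Cof_Fib assms f by simp
  ultimately obtain h where "h \<in> hom C Z X" "h \<cdot> i = Ide C X"
    using v unfolding has_lifting_def homD(2,3)[OF assms(3)] homD(2,3)[OF f(1)] by blast
  then show ?thesis by (rule that)
qed

text \<open>
  Dual to \<open>triv_cof_retraction\<close>: lift the identity of \<open>Y\<close> through \<open>p\<close>, starting from an initial object.
\<close>

lemma triv_fib_section:
  assumes "p \<in> Fib" "p \<in> W" "p \<in> hom C Z Y" "cofibrant C Cof Y"
  obtains s where "s \<in> hom C Y Z" "p \<cdot> s = Ide C Y"
proof -
  obtain I f where I: "is_initial C I" and f: "f \<in> hom C I Y" "f \<in> Cof"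
    using assms by (auto simp: cofibrant_def)
  have "Z \<in> Obj C" using assms hom_objs by blast
  then obtain v where v: "v \<in> hom C I Z"
    using I unfolding is_initial_def by blast
  have Y: "Y \<in> Obj C" using assms hom_objs by blast
  have "\<exists>!h. h \<in> hom C I Y" using I Y by (simp add: is_initial_def)
  then have "p \<cdot> v = Ide C Y \<cdot> f"
    using cmp_in[OF v assms(3)] cmp_in[OF f(1) ide_in[OF Y]] by blast
  moreover have "Ide C Y \<in> hom C Y Y" using Y by (rule ide_in)
  moreover have "has_lifting C f p" using lift_Cof_triv_Fib assms f by simp
  ultimately obtain h where "h \<in> hom C Y Z" "p \<cdot> h = Ide C Y"
    using v unfolding has_lifting_def homD(2,3)[OF assms(3)] homD(2,3)[OF f(1)] by blast
  then show ?thesis by (rule that)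
qed

text \<open>
  The middle object stays fibrant-cofibrant: it is cofibrant through \<open>X\<close> and fibrant through \<open>Y\<close>.
\<close>

lemma weak_equivalence_factor:
  assumes w: "w \<in> W" "w \<in> hom D X Y"
  obtains Z i p where "i \<in> hom D X Z" "i \<in> Cof" "i \<in> W" "p \<in> hom D Z Y" "p \<in> Fib" "p \<in> W"
    "w = p \<cdot> i"
proof -
  have wC: "w \<in> hom C X Y" and XY: "X \<in> Obj D" "Y \<in> Obj D" using w hom_D_iff by auto
  obtain i p where ip: "i \<in> Cof" "i \<in> W" "p \<in> Fib" "Dom C i = Dom C w" "Cod C p = Cod C w"
    "Cod C i = Dom C p" "w = p \<cdot> i"
    using factor_triv_Cof_Fib[of w] homD[OF wC] by blast
  define Z where "Z = Cod C i"
  have i: "i \<in> hom C X Z" and p: "p \<in> hom C Z Y"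
    using ip homD[OF wC] Cof_wide Fib_wide by (auto simp: hom_def Z_def wide_subcategory_def)
  have "p \<in> W" using W_cancel_right[OF i p] ip w by simp
  have "cofibrant C Cof Z"
  proof -
    obtain I f where I: "is_initial C I" and f: "f \<in> hom C I X" "f \<in> Cof"
      using XY by (auto simp: obj_D_iff cofibrant_def)
    have "i \<cdot> f \<in> Cof" using Cof_wide ip i f by (auto simp: wide_subcategory_def hom_def)
    then show ?thesis using I cmp_in[OF f(1) i] hom_objs[OF i] unfolding cofibrant_def by blast
  qed
  moreover have "fibrant C Fib Z"
  proof -
    obtain T f where T: "is_terminal C T" and f: "f \<in> hom C Y T" "f \<in> Fib"
      using XY by (auto simp: obj_D_iff fibrant_def)
    have "f \<cdot> p \<in> Fib" using Fib_wide ip p f by (auto simp: wide_subcategory_def hom_def)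
    then show ?thesis using T cmp_in[OF p f(1)] hom_objs[OF i] unfolding fibrant_def by blast
  qed
  ultimately have "Z \<in> Obj D" by (simp add: obj_D_iff)
  then show ?thesis using that i p ip \<open>p \<in> W\<close> XY by (simp add: hom_D_iff)
qed

text \<open>
  The form of Whitehead's theorem used here. The category \<open>E\<close> need not consist of classes of arrows
  of \<open>D\<close>, so that \<open>\<gamma>\<close> inverts \<open>w\<close> does not by itself give an inverse of the class of \<open>w\<close>: the
  inverse has to come from an arrow of \<open>D\<close>, and lifting supplies one for each factor of \<open>w\<close>.
\<close>

lemma quotient_inverts:
  assumes \<gamma>: "inverts D (W \<inter> Arr D) E \<gamma>"
  shows "inverts D (W \<inter> Arr D) (quotient_cat D (homotopical D \<gamma>)) (quotient_functor D \<gamma>)"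
proof -
  have \<gamma>f: "is_functor D E \<gamma>" and iso: "\<And>w X Y. w \<in> hom D X Y \<Longrightarrow> w \<in> W \<Longrightarrow> is_iso E (amap \<gamma> w)"
    using \<gamma> by (auto simp: inverts_def dest: homD)
  interpret D: category D by (rule category_D)
  interpret E: category E by (rule functor_cats(2)[OF \<gamma>f])
  let ?H = "quotient_cat D (homotopical D \<gamma>)"
  interpret H: category ?H by (rule category_quotient_cat[OF \<gamma>f])
  note K = is_functor_quotient_functor[OF \<gamma>f]
  note cmp = functor_cmp[OF \<gamma>f, simplified]
  note ide = functor_ide[OF \<gamma>f, simplified]
  have *: "is_iso ?H (homotopical D \<gamma> `` {w})" if w: "w \<in> hom D X Y" "w \<in> W" for w X Y
  proof -
    obtain Z i p where ip: "i \<in> hom D X Z" "i \<in> Cof" "i \<in> W" "p \<in> hom D Z Y" "p \<in> Fib" "p \<in> W"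
      "w = p \<cdot> i"
      using weak_equivalence_factor w by metis
    have obj: "X \<in> Obj D" "Y \<in> Obj D" "Z \<in> Obj D" using ip D.hom_objs by blast+
    obtain s where s: "s \<in> hom D Z X" "s \<cdot> i = Ide C X"
      using triv_cof_retraction ip obj by (metis hom_D_iff obj_D_iff)
    obtain t where t: "t \<in> hom D Y Z" "p \<cdot> t = Ide C Y"
      using triv_fib_section ip obj by (metis hom_D_iff obj_D_iff)
    note h = functor_hom[OF \<gamma>f ip(1)] functor_hom[OF \<gamma>f ip(4)]
      functor_hom[OF \<gamma>f s(1)] functor_hom[OF \<gamma>f t(1)]
    \<comment> \<open>\<open>\<gamma> i\<close> is invertible, so its left inverse \<open>\<gamma> s\<close> is also a right inverse; dually for \<open>p\<close>.\<close>
    have "amap \<gamma> (i \<cdot> s) = Ide E (omap \<gamma> Z)"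
      using E.left_inverse_of_iso[OF iso h(1,3)] ip s cmp ide obj by metis
    then have i: "is_iso ?H (homotopical D \<gamma> `` {i})"
      using quotient_iso[OF \<gamma>f ip(1) s(1)] s ide obj by simp
    have "amap \<gamma> (t \<cdot> p) = Ide E (omap \<gamma> Z)"
      using E.right_inverse_of_iso[OF iso h(2,4)] ip t cmp ide obj by metis
    then have p: "is_iso ?H (homotopical D \<gamma> `` {p})"
      using quotient_iso[OF \<gamma>f ip(4) t(1)] t ide obj by simp
    show ?thesis
      using H.iso_cmp[OF i _ p] functor_hom[OF K ip(1)] functor_hom[OF K ip(4)]
        functor_cmp[OF K ip(1,4)] ip(7) by simp
  qed
  show ?thesis
    unfolding inverts_def using K * by (auto dest: homI)
qed

end

lemma inverts_functor: "inverts C W E F \<Longrightarrow> is_functor C E F"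
  by (simp add: inverts_def)

lemma inverts_iso: "inverts C W E F \<Longrightarrow> w \<in> W \<Longrightarrow> is_iso E (amap F w)"
  by (simp add: inverts_def)

section \<open>Comparing an object with its replacement\<close>

locale model_with_replacements = model_category C W Fib Cof
  for C :: "('o, 'a) cat" (structure) and W Fib Cof :: "'a set" +
  fixes Q R :: "('o, 'a, 'o, 'a) cfunctor" and q r :: "'o \<Rightarrow> 'a"
  assumes Q_replacement: "cofibrant_replacement C W Cof Q q"
    and R_replacement: "fibrant_replacement C W Fib Cof R r"
begin

abbreviation RQ where "RQ \<equiv> comp_functor R Q"

lemma Q_functor: "is_functor C C Q"
  using Q_replacement by (simp add: cofibrant_replacement_def)

lemma Q_functor_Cc: "is_functor C Cc Q"
proof (rule is_functorI)
  have obj: "omap Q X \<in> Obj Cc" if "X \<in> Obj C" for X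
    using that Q_replacement by (simp add: cofibrant_replacement_def obj_Cc_iff)
  then show "\<And>X. X \<in> Obj C \<Longrightarrow> omap Q X \<in> Obj Cc" .
  show "amap Q f \<in> hom Cc (omap Q X) (omap Q Y)" if "f \<in> hom C X Y" for f X Y
    using functor_hom[OF Q_functor that] obj hom_objs[OF that] by (simp add: hom_Cc_iff)
qed (simp_all add: category_Cc category_axioms functor_ide[OF Q_functor] functor_cmp[OF Q_functor])

lemma R_functor_Cc: "is_functor Cc Cc R"
  using R_replacement by (simp add: fibrant_replacement_def)

lemma R_functor: "is_functor Cc D R"
proof (rule is_functorI)
  have obj: "omap R X \<in> Obj D" if "X \<in> Obj Cc" for X
    using that R_replacement by (simp add: fibrant_replacement_def)
  then show "\<And>X. X \<in> Obj Cc \<Longrightarrow> omap R X \<in> Obj D" .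
  show "amap R f \<in> hom D (omap R X) (omap R Y)" if "f \<in> hom Cc X Y" for f X Y
    using functor_hom[OF R_functor_Cc that] obj category.hom_objs[OF category_Cc that]
    by (simp add: hom_Cc_iff hom_D_iff)
qed (simp_all add: category_Cc category_D functor_ide[OF R_functor_Cc, simplified]
    functor_cmp[OF R_functor_Cc, simplified])

lemma RQ_functor: "is_functor C D RQ"
  using comp_functor[OF Q_functor_Cc R_functor] .

lemma RQ_obj: "X \<in> Obj C \<Longrightarrow> omap R (omap Q X) \<in> Obj D"
  using functor_obj[OF RQ_functor] by simp

lemma Cc_obj: "X \<in> Obj Cc \<Longrightarrow> X \<in> Obj C"
  by (simp add: cof_cat_def)

lemma D_obj: "X \<in> Obj D \<Longrightarrow> X \<in> Obj C"
  by (simp add: fibcof_cat_def)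

lemma Q_W: "w \<in> W \<Longrightarrow> amap Q w \<in> W"
  using Q_replacement by (simp add: cofibrant_replacement_def)

lemma R_W: "w \<in> W \<Longrightarrow> w \<in> hom Cc A B \<Longrightarrow> amap R w \<in> W"
  using R_replacement by (simp add: fibrant_replacement_def homD)

lemma q_hom: "X \<in> Obj C \<Longrightarrow> q X \<in> hom C (omap Q X) X"
  and q_natural: "f \<in> hom C X Y \<Longrightarrow> q Y \<cdot> amap Q f = f \<cdot> q X"
  and q_W: "X \<in> Obj C \<Longrightarrow> q X \<in> W"
proof -
  have "is_nat_trans C C Q id_functor q"
    using Q_replacement by (simp add: cofibrant_replacement_def)
  from nat_trans_hom[OF this] nat_trans_natural[OF this]
  show "X \<in> Obj C \<Longrightarrow> q X \<in> hom C (omap Q X) X"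
    "f \<in> hom C X Y \<Longrightarrow> q Y \<cdot> amap Q f = f \<cdot> q X"
    by (simp_all add: id_functor_def)
  show "X \<in> Obj C \<Longrightarrow> q X \<in> W"
    using Q_replacement by (simp add: cofibrant_replacement_def)
qed

lemma q_hom_Cc: "A \<in> Obj Cc \<Longrightarrow> q A \<in> hom Cc (omap Q A) A"
  using q_hom[of A] functor_obj[OF Q_functor_Cc, of A] Cc_obj[of A] by (simp add: hom_Cc_iff)

lemma r_hom: "A \<in> Obj Cc \<Longrightarrow> r A \<in> hom Cc A (omap R A)"
  and r_natural: "f \<in> hom Cc A B \<Longrightarrow> r B \<cdot> f = amap R f \<cdot> r A"
  and r_W: "A \<in> Obj Cc \<Longrightarrow> r A \<in> W"
proof -
  have "is_nat_trans Cc Cc id_functor R r"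
    using R_replacement by (simp add: fibrant_replacement_def)
  from nat_trans_hom[OF this] nat_trans_natural[OF this]
  show "A \<in> Obj Cc \<Longrightarrow> r A \<in> hom Cc A (omap R A)"
    "f \<in> hom Cc A B \<Longrightarrow> r B \<cdot> f = amap R f \<cdot> r A"
    by (simp_all add: id_functor_def)
  show "A \<in> Obj Cc \<Longrightarrow> r A \<in> W"
    using R_replacement by (simp add: fibrant_replacement_def)
qed

lemma r_hom_D: "A \<in> Obj D \<Longrightarrow> r A \<in> hom D A (omap R A)"
  using r_hom[OF obj_D_imp_Cc] functor_obj[OF R_functor obj_D_imp_Cc]
  by (simp add: hom_D_iff hom_Cc_iff)

lemma hom_D_imp_Cc: "f \<in> hom D X Y \<Longrightarrow> f \<in> hom Cc X Y"
  by (simp add: hom_D_iff hom_Cc_iff obj_D_imp_Cc)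

lemma inverts_D_iso:
  assumes "inverts D (W \<inter> Arr D) E K" "w \<in> W" "w \<in> hom D X Y"
  shows "is_iso E (amap K w)"
  using inverts_iso[OF assms(1)] W_D_iff assms by blast

lemma inverts_R:
  assumes "inverts D (W \<inter> Arr D) E K"
  shows "inverts Cc (W \<inter> Arr Cc) E (comp_functor K R)"
  unfolding inverts_def
  using comp_functor[OF R_functor inverts_functor[OF assms]]
    inverts_D_iso[OF assms R_W functor_hom[OF R_functor]]
  by (auto dest: homI)

lemma inverts_RQ:
  assumes "inverts D (W \<inter> Arr D) E K"
  shows "inverts C W E (comp_functor K RQ)"
proof -
  have "is_iso E (amap K (amap RQ w))" if "w \<in> W" for w
  proof -
    have "w \<in> hom C (Dom C w) (Cod C w)"
      using that W_wide by (auto simp: wide_subcategory_def intro: homI)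
    from functor_hom[OF Q_functor_Cc this] functor_hom[OF RQ_functor this] show ?thesis
      using inverts_D_iso[OF assms R_W[OF Q_W[OF that]]] by auto
  qed
  then show ?thesis
    using comp_functor[OF RQ_functor inverts_functor[OF assms]] by (simp add: inverts_def)
qed

text \<open>
  Naturality of \<open>r\<close> makes \<open>K u\<close> and \<open>K (R u)\<close> conjugate by isomorphisms that do not depend on \<open>u\<close>.
\<close>

lemma R_reflects_equality:
  assumes K: "inverts D (W \<inter> Arr D) E K" and u: "u \<in> hom D A B" and v: "v \<in> hom D A B"
    and eq: "amap K (amap R u) = amap K (amap R v)"
  shows "amap K u = amap K v"
proof -
  note Kf = inverts_functor[OF K]
  interpret E: category E by (rule functor_cats(2)[OF Kf])
  interpret D: category D by (rule category_D)
  have rA: "r A \<in> hom D A (omap R A)" and rB: "r B \<in> hom D B (omap R B)" and B: "B \<in> Obj D"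
    using r_hom_D D.hom_objs[OF u] by blast+
  have *: "amap K (r B) \<cdot>\<^bsub>E\<^esub> amap K x = amap K (amap R x) \<cdot>\<^bsub>E\<^esub> amap K (r A)"
    if x: "x \<in> hom D A B" for x
    using functor_cmp[OF Kf x rB] r_natural[OF hom_D_imp_Cc[OF x]]
      functor_cmp[OF Kf rA functor_hom[OF R_functor hom_D_imp_Cc[OF x]]]
    by simp
  show ?thesis
  proof (rule E.iso_cancel_left)
    show "is_iso E (amap K (r B))" by (rule inverts_D_iso[OF K r_W[OF obj_D_imp_Cc[OF B]] rB])
    show "amap K (r B) \<in> hom E (omap K B) (omap K (omap R B))" by (rule functor_hom[OF Kf rB])
    show "amap K u \<in> hom E (omap K A) (omap K B)" "amap K v \<in> hom E (omap K A) (omap K B)"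
      using functor_hom[OF Kf] u v by blast+
    show "amap K (r B) \<cdot>\<^bsub>E\<^esub> amap K u = amap K (r B) \<cdot>\<^bsub>E\<^esub> amap K v"
      using *[OF u] *[OF v] eq by simp
  qed
qed

text \<open>
  The same argument with \<open>R q\<close> in place of \<open>r\<close>. As \<open>u\<close> is only an arrow between cofibrant objects,
  \<open>K\<close> is applied after \<open>R\<close>.
\<close>

lemma Q_reflects_equality:
  assumes K: "inverts D (W \<inter> Arr D) E K" and u: "u \<in> hom Cc A B" and v: "v \<in> hom Cc A B"
    and eq: "amap K (amap RQ u) = amap K (amap RQ v)"
  shows "amap K (amap R u) = amap K (amap R v)"
proof -
  note KR = inverts_R[OF K]
  note KRf = inverts_functor[OF KR]
  interpret E: category E by (rule functor_cats(2)[OF KRf])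
  interpret Cc: category Cc by (rule category_Cc)
  have qA: "q A \<in> hom Cc (omap Q A) A" and qB: "q B \<in> hom Cc (omap Q B) B"
    using q_hom_Cc Cc.hom_objs[OF u] by blast+
  have A: "A \<in> Obj C" using qA by (auto simp: hom_Cc_iff dest: hom_objs)
  have *: "amap K (amap R x) \<cdot>\<^bsub>E\<^esub> amap K (amap R (q A))
      = amap K (amap R (q B)) \<cdot>\<^bsub>E\<^esub> amap K (amap RQ x)"
    if x: "x \<in> hom Cc A B" for x
  proof -
    have xC: "x \<in> hom C A B" using x by (simp add: hom_Cc_iff)
    show ?thesis
      using functor_cmp[OF KRf qA x] q_natural[OF xC]
        functor_cmp[OF KRf functor_hom[OF Q_functor_Cc xC] qB]
      by simp
  qed
  show ?thesis
  proof (rule E.iso_cancel_right)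
    show "is_iso E (amap K (amap R (q A)))"
      using inverts_iso[OF KR, of "q A"] q_W[OF A] homD(1)[OF qA] by simp
    show "amap K (amap R (q A)) \<in> hom E (omap K (omap R (omap Q A))) (omap K (omap R A))"
      using functor_hom[OF KRf qA] by simp
    show "amap K (amap R u) \<in> hom E (omap K (omap R A)) (omap K (omap R B))"
      "amap K (amap R v) \<in> hom E (omap K (omap R A)) (omap K (omap R B))"
      using functor_hom[OF KRf u] functor_hom[OF KRf v] by simp_all
    show "amap K (amap R u) \<cdot>\<^bsub>E\<^esub> amap K (amap R (q A))
        = amap K (amap R v) \<cdot>\<^bsub>E\<^esub> amap K (amap R (q A))"
      using *[OF u] *[OF v] eq by simp
  qed
qed

text \<open>
  Naturality of \<open>r\<close> at \<open>r A\<close> says that both arrows have the same composite with \<open>r A\<close>. Since \<open>r A\<close> may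
  start outside \<open>D\<close>, it can be cancelled only after applying \<open>R\<close>, which \<open>R_reflects_equality\<close> then
  removes.
\<close>

lemma r_R_eq_R_r:
  assumes K: "inverts D (W \<inter> Arr D) E K" and A: "A \<in> Obj Cc"
  shows "amap K (r (omap R A)) = amap K (amap R (r A))"
proof -
  note KR = inverts_R[OF K]
  note KRf = inverts_functor[OF KR]
  interpret E: category E by (rule functor_cats(2)[OF KRf])
  let ?RA = "omap R A"
  have RA: "?RA \<in> Obj D" by (rule functor_obj[OF R_functor A])
  have u: "r ?RA \<in> hom D ?RA (omap R ?RA)" by (rule r_hom_D[OF RA])
  have rA: "r A \<in> hom Cc A ?RA" by (rule r_hom[OF A])
  have v: "amap R (r A) \<in> hom D ?RA (omap R ?RA)" by (rule functor_hom[OF R_functor rA])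
  note uC = hom_D_imp_Cc[OF u] and vC = hom_D_imp_Cc[OF v]
  show ?thesis
  proof (rule R_reflects_equality[OF K u v], rule E.iso_cancel_right)
    show "is_iso E (amap K (amap R (r A)))"
      using inverts_iso[OF KR, of "r A"] r_W[OF A] homD(1)[OF rA] by simp
    show "amap K (amap R (r A)) \<in> hom E (omap K (omap R A)) (omap K (omap R ?RA))"
      using functor_hom[OF KRf rA] by simp
    show "amap K (amap R (r ?RA)) \<in> hom E (omap K (omap R ?RA)) (omap K (omap R (omap R ?RA)))"
      "amap K (amap R (amap R (r A))) \<in> hom E (omap K (omap R ?RA)) (omap K (omap R (omap R ?RA)))"
      using functor_hom[OF KRf uC] functor_hom[OF KRf vC] by simp_all
    show "amap K (amap R (r ?RA)) \<cdot>\<^bsub>E\<^esub> amap K (amap R (r A))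
        = amap K (amap R (amap R (r A))) \<cdot>\<^bsub>E\<^esub> amap K (amap R (r A))"
      using functor_cmp[OF KRf rA uC] functor_cmp[OF KRf rA vC] r_natural[OF rA] by simp
  qed
qed

text \<open>
  Naturality of \<open>q\<close> at \<open>q X\<close> says that both arrows have the same composite with \<open>q X\<close>, which becomes
  cancellable after applying \<open>RQ\<close>; the extra \<open>Q\<close> is removed by \<open>Q_reflects_equality\<close>.
\<close>

lemma q_Q_eq_Q_q:
  assumes K: "inverts D (W \<inter> Arr D) E K" and X: "X \<in> Obj C"
  shows "amap K (amap R (q (omap Q X))) = amap K (amap R (amap Q (q X)))"
proof -
  note KRQ = inverts_RQ[OF K]
  note KRQf = inverts_functor[OF KRQ]
  interpret E: category E by (rule functor_cats(2)[OF KRQf])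
  let ?QX = "omap Q X"
  have QX: "?QX \<in> Obj Cc" by (rule functor_obj[OF Q_functor_Cc X])
  have u: "q ?QX \<in> hom Cc (omap Q ?QX) ?QX" by (rule q_hom_Cc[OF QX])
  have qX: "q X \<in> hom C ?QX X" by (rule q_hom[OF X])
  have v: "amap Q (q X) \<in> hom Cc (omap Q ?QX) ?QX" by (rule functor_hom[OF Q_functor_Cc qX])
  have uC: "q ?QX \<in> hom C (omap Q ?QX) ?QX" and vC: "amap Q (q X) \<in> hom C (omap Q ?QX) ?QX"
    using u v by (simp_all add: hom_Cc_iff)
  show ?thesis
  proof (rule Q_reflects_equality[OF K u v], rule E.iso_cancel_left)
    show "is_iso E (amap K (amap RQ (q X)))"
      using inverts_iso[OF KRQ q_W[OF X]] by simp
    show "amap K (amap RQ (q X)) \<in> hom E (omap K (omap RQ ?QX)) (omap K (omap RQ X))"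
      using functor_hom[OF KRQf qX] by simp
    show "amap K (amap RQ (q ?QX)) \<in> hom E (omap K (omap RQ (omap Q ?QX))) (omap K (omap RQ ?QX))"
      "amap K (amap RQ (amap Q (q X)))
        \<in> hom E (omap K (omap RQ (omap Q ?QX))) (omap K (omap RQ ?QX))"
      using functor_hom[OF KRQf uC] functor_hom[OF KRQf vC] by simp_all
    show "amap K (amap RQ (q X)) \<cdot>\<^bsub>E\<^esub> amap K (amap RQ (q ?QX))
        = amap K (amap RQ (q X)) \<cdot>\<^bsub>E\<^esub> amap K (amap RQ (amap Q (q X)))"
      using functor_cmp[OF KRQf uC qX] functor_cmp[OF KRQf vC qX] q_natural[OF qX] by simp
  qed
qed

text \<open>
  The image under \<open>F\<close> of the zigzag \<open>X \<leftarrow> QX \<rightarrow> RQX\<close> of weak equivalences; it makes sense when \<open>F\<close>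
  inverts them.
\<close>

definition comparison :: "('x, 'y) cat \<Rightarrow> ('o, 'a, 'x, 'y) cfunctor \<Rightarrow> 'o \<Rightarrow> 'y" where
  "comparison E F X = amap F (r (omap Q X)) \<cdot>\<^bsub>E\<^esub> inverse_arr E (amap F (q X))"

lemma rQ_hom:
  assumes "X \<in> Obj C"
  shows "r (omap Q X) \<in> hom C (omap Q X) (omap RQ X)" "r (omap Q X) \<in> W"
  using r_hom r_W functor_obj[OF Q_functor_Cc assms] by (simp_all add: hom_Cc_iff)

lemma
  assumes F: "inverts C W E F" and X: "X \<in> Obj C"
  shows comparison_hom: "comparison E F X \<in> hom E (omap F X) (omap F (omap RQ X))"
    and comparison_iso: "is_iso E (comparison E F X)"
    and comparison_q: "comparison E F X \<cdot>\<^bsub>E\<^esub> amap F (q X) = amap F (r (omap Q X))"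
proof -
  note Ff = inverts_functor[OF F]
  interpret E: category E by (rule functor_cats(2)[OF Ff])
  note hq = functor_hom[OF Ff q_hom[OF X]] and hr = functor_hom[OF Ff rQ_hom(1)[OF X]]
  note iq = inverts_iso[OF F q_W[OF X]] and ir = inverts_iso[OF F rQ_hom(2)[OF X]]
  note inv = E.inverse_arr[OF iq hq]
  show "comparison E F X \<in> hom E (omap F X) (omap F (omap RQ X))"
    unfolding comparison_def by (rule E.cmp_in[OF inv(1) hr])
  show "is_iso E (comparison E F X)"
    unfolding comparison_def by (rule E.iso_cmp[OF E.iso_inverse_arr[OF iq hq] inv(1) ir hr])
  show "comparison E F X \<cdot>\<^bsub>E\<^esub> amap F (q X) = amap F (r (omap Q X))"
    unfolding comparison_def
    using E.cmp_assoc[OF hq inv(1) hr] inv(2) E.ide_right[OF hr] by simp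
qed

lemma comparison_natural:
  assumes F: "inverts C W E F" and f: "f \<in> hom C X Y"
  shows "comparison E F Y \<cdot>\<^bsub>E\<^esub> amap F f = amap F (amap RQ f) \<cdot>\<^bsub>E\<^esub> comparison E F X"
proof -
  note Ff = inverts_functor[OF F]
  interpret E: category E by (rule functor_cats(2)[OF Ff])
  have X: "X \<in> Obj C" and Y: "Y \<in> Obj C" using hom_objs[OF f] .
  have Qf: "amap Q f \<in> hom Cc (omap Q X) (omap Q Y)" by (rule functor_hom[OF Q_functor_Cc f])
  then have QfC: "amap Q f \<in> hom C (omap Q X) (omap Q Y)" by (simp add: hom_Cc_iff)
  have RQf: "amap RQ f \<in> hom C (omap RQ X) (omap RQ Y)"
    using functor_hom[OF RQ_functor f] by (simp add: hom_D_iff)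
  note hF = functor_hom[OF Ff]
  note hX = comparison_hom[OF F X] and hY = comparison_hom[OF F Y]
  show ?thesis
  proof (rule E.iso_cancel_right)
    show "is_iso E (amap F (q X))" by (rule inverts_iso[OF F q_W[OF X]])
    show "amap F (q X) \<in> hom E (omap F (omap Q X)) (omap F X)" by (rule hF[OF q_hom[OF X]])
    show "comparison E F Y \<cdot>\<^bsub>E\<^esub> amap F f \<in> hom E (omap F X) (omap F (omap RQ Y))"
      by (rule E.cmp_in[OF hF[OF f] hY])
    show "amap F (amap RQ f) \<cdot>\<^bsub>E\<^esub> comparison E F X \<in> hom E (omap F X) (omap F (omap RQ Y))"
      by (rule E.cmp_in[OF hX hF[OF RQf]])
    have "(comparison E F Y \<cdot>\<^bsub>E\<^esub> amap F f) \<cdot>\<^bsub>E\<^esub> amap F (q X)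
        = comparison E F Y \<cdot>\<^bsub>E\<^esub> amap F (f \<cdot> q X)"
      using E.cmp_assoc[OF hF[OF q_hom[OF X]] hF[OF f] hY] functor_cmp[OF Ff q_hom[OF X] f] by simp
    also have "\<dots> = comparison E F Y \<cdot>\<^bsub>E\<^esub> (amap F (q Y) \<cdot>\<^bsub>E\<^esub> amap F (amap Q f))"
      using functor_cmp[OF Ff QfC q_hom[OF Y]] q_natural[OF f] by simp
    also have "\<dots> = amap F (r (omap Q Y)) \<cdot>\<^bsub>E\<^esub> amap F (amap Q f)"
      using E.cmp_assoc[OF hF[OF QfC] hF[OF q_hom[OF Y]] hY] comparison_q[OF F Y] by simp
    also have "\<dots> = amap F (amap RQ f) \<cdot>\<^bsub>E\<^esub> amap F (r (omap Q X))"
      using functor_cmp[OF Ff QfC rQ_hom(1)[OF Y]] functor_cmp[OF Ff rQ_hom(1)[OF X] RQf]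
        r_natural[OF Qf] by simp
    also have "\<dots> = (amap F (amap RQ f) \<cdot>\<^bsub>E\<^esub> comparison E F X) \<cdot>\<^bsub>E\<^esub> amap F (q X)"
      using E.cmp_assoc[OF hF[OF q_hom[OF X]] hX hF[OF RQf]] comparison_q[OF F X] by simp
    finally show "(comparison E F Y \<cdot>\<^bsub>E\<^esub> amap F f) \<cdot>\<^bsub>E\<^esub> amap F (q X) = \<dots>" .
  qed
qed

text \<open>
  The comparison is determined by its composite with \<open>F(q X)\<close>, so it is preserved by every functor
  through which \<open>F\<close> factors.
\<close>

lemma functor_comparison:
  assumes L: "inverts C W H L" and F: "inverts C W E F"
    and G: "is_functor H E G" and eq: "functor_eq C (comp_functor G L) F" and X: "X \<in> Obj C"
  shows "amap G (comparison H L X) = comparison E F X"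
proof -
  note Ff = inverts_functor[OF F]
  interpret E: category E by (rule functor_cats(2)[OF Ff])
  note hL = functor_hom[OF inverts_functor[OF L] q_hom[OF X]]
  have obj: "omap G (omap L X) = omap F X" "omap G (omap L (omap RQ X)) = omap F (omap RQ X)"
    using functor_eq_obj[OF eq] X D_obj[OF RQ_obj[OF X]] by simp_all
  have arr: "amap G (amap L (q X)) = amap F (q X)"
    "amap G (amap L (r (omap Q X))) = amap F (r (omap Q X))"
    using functor_eq_arr[OF eq q_hom[OF X]] functor_eq_arr[OF eq rQ_hom(1)[OF X]] by simp_all
  show ?thesis
  proof (rule E.iso_cancel_right)
    show "is_iso E (amap F (q X))" by (rule inverts_iso[OF F q_W[OF X]])
    show "amap F (q X) \<in> hom E (omap F (omap Q X)) (omap F X)"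
      by (rule functor_hom[OF Ff q_hom[OF X]])
    show "comparison E F X \<in> hom E (omap F X) (omap F (omap RQ X))"
      by (rule comparison_hom[OF F X])
    show "amap G (comparison H L X) \<in> hom E (omap F X) (omap F (omap RQ X))"
      using functor_hom[OF G comparison_hom[OF L X]] obj by simp
    show "amap G (comparison H L X) \<cdot>\<^bsub>E\<^esub> amap F (q X) = comparison E F X \<cdot>\<^bsub>E\<^esub> amap F (q X)"
      using functor_cmp[OF G hL comparison_hom[OF L X]] comparison_q[OF L X] comparison_q[OF F X]
        arr by simp
  qed
qed

section \<open>The homotopy category\<close>

context
  fixes E\<^sub>0 :: "('p, 'b) cat" and \<gamma> :: "('o, 'a, 'p, 'b) cfunctor"
  assumes \<gamma>: "inverts D (W \<inter> Arr D) E\<^sub>0 \<gamma>"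
begin

abbreviation Hfc where "Hfc \<equiv> quotient_cat D (homotopical D \<gamma>)"
abbreviation cls where "cls f \<equiv> homotopical D \<gamma> `` {f}"
abbreviation H where "H \<equiv> homotopy_cat C Fib Cof Q R \<gamma>"
abbreviation L where "L \<equiv> homotopy_functor C Fib Cof Q R \<gamma>"

lemma K_inverts: "inverts D (W \<inter> Arr D) Hfc (quotient_functor D \<gamma>)"
  by (rule quotient_inverts[OF \<gamma>])

lemmas K_functor = inverts_functor[OF K_inverts]

lemma H_eq: "H = pullback_cat C (omap RQ) Hfc"
  by (simp add: homotopy_cat_def Let_def)

lemma H_simps [simp]:
  "Obj H = Obj C" "Ide H X = (X, cls (Ide C (omap R (omap Q X))), X)"
  "(Y', l, Z) \<cdot>\<^bsub>H\<^esub> (X, k, Y) = (X, l \<cdot>\<^bsub>Hfc\<^esub> k, Z)"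
  by (simp_all add: H_eq)

lemma L_simps [simp]:
  "omap L X = X"
  "f \<in> hom C X Y \<Longrightarrow> amap L f = (X, cls (amap R (amap Q f)), Y)"
  by (auto simp: homotopy_functor_def hom_def)

lemma category_Hfc: "category Hfc"
  by (rule functor_cats(2)[OF K_functor])

lemma category_H: "category H"
  unfolding H_eq by (rule category_pullback_cat) (simp_all add: category_Hfc RQ_obj)

lemma hom_H: "a \<in> hom H X Y \<longleftrightarrow> X \<in> Obj C \<and> Y \<in> Obj C
    \<and> (\<exists>k \<in> hom Hfc (omap R (omap Q X)) (omap R (omap Q Y)). a = (X, k, Y))"
  by (auto simp: H_eq hom_pullback_cat)

lemma cls_cmp:
  "f \<in> hom D X Y \<Longrightarrow> g \<in> hom D Y Z \<Longrightarrow> cls g \<cdot>\<^bsub>Hfc\<^esub> cls f = cls (g \<cdot> f)"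
  using functor_cmp[OF K_functor] by simp

lemma cls_hom: "f \<in> hom D X Y \<Longrightarrow> cls f \<in> hom Hfc X Y"
  using functor_hom[OF K_functor] by simp

lemma L_functor: "is_functor C H L"
proof (rule is_functorI)
  note RQ_hom = functor_hom[OF RQ_functor, simplified]
  show "amap L f \<in> hom H (omap L X) (omap L Y)" if f: "f \<in> hom C X Y" for f X Y
    using f hom_objs[OF f] cls_hom[OF RQ_hom[OF f]] by (simp add: hom_H)
  show "amap L (Ide C X) = Ide H (omap L X)" if X: "X \<in> Obj C" for X
    using L_simps(2)[OF ide_in[OF X]] functor_ide[OF RQ_functor X] by simp
  show "amap L (g \<cdot> f) = amap L g \<cdot>\<^bsub>H\<^esub> amap L f"
    if f: "f \<in> hom C X Y" and g: "g \<in> hom C Y Z" for f g X Y Z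
    using L_simps(2)[OF cmp_in[OF f g]] L_simps(2)[OF f] L_simps(2)[OF g]
      cls_cmp[OF RQ_hom[OF f] RQ_hom[OF g]] functor_cmp[OF RQ_functor f g] by simp
qed (simp_all add: category_axioms category_H)

lemma L_inverts: "inverts C W H L"
  unfolding inverts_def
proof (intro conjI ballI L_functor)
  fix w assume w: "w \<in> W"
  define X Y where "X = Dom C w" and "Y = Cod C w"
  have wC: "w \<in> hom C X Y"
    using w W_wide by (auto simp: wide_subcategory_def X_def Y_def intro: homI)
  have "is_iso Hfc (cls (amap R (amap Q w)))"
    using inverts_iso[OF inverts_RQ[OF K_inverts] w] by simp
  then have "is_iso H (X, cls (amap R (amap Q w)), Y)"
    unfolding H_eq using hom_objs[OF wC] cls_hom[OF functor_hom[OF RQ_functor wC]]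
    by (intro pullback_iso) (simp_all add: category_Hfc RQ_obj)
  then show "is_iso H (amap L w)" using wC by simp
qed

text \<open>
  The middle component \<open>s\<close> of the comparison of \<open>L\<close> at \<open>Z\<close> is the class \<open>[RQ(r\<^sub>Q\<^sub>Z)] [RQ(q\<^sub>Z)]\<inverse>\<close>, from
  \<open>P = RQZ\<close> to \<open>RQP\<close>. It depends on \<open>Z\<close> only through \<open>P\<close>, being \<open>[R(q\<^sub>P)]\<inverse> [r\<^sub>P]\<close>, and in
  this form it is natural in \<open>P\<close>. Indeed, by naturality of \<open>q\<close> at \<open>r\<^sub>Q\<^sub>Z\<close>,
  \<open>[R(q\<^sub>P)] [RQ(r\<^sub>Q\<^sub>Z)] = [R(r\<^sub>Q\<^sub>Z)] [R(q\<^sub>Q\<^sub>Z)] = [r\<^sub>P] [RQ(q\<^sub>Z)]\<close>.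
\<close>

lemma comparison_middle:
  assumes Z: "Z \<in> Obj C"
  obtains s where "comparison H L Z = (Z, s, omap R (omap Q Z))"
    and "s \<in> hom Hfc (omap R (omap Q Z)) (omap R (omap Q (omap R (omap Q Z))))"
    and "cls (amap R (q (omap R (omap Q Z)))) \<cdot>\<^bsub>Hfc\<^esub> s = cls (r (omap R (omap Q Z)))"
proof -
  interpret Hfc: category Hfc by (rule category_Hfc)
  let ?QZ = "omap Q Z" let ?P = "omap R ?QZ"
  note KRf = inverts_functor[OF inverts_R[OF K_inverts]]
  note KRQ = inverts_RQ[OF K_inverts]
  have QZ: "?QZ \<in> Obj Cc" by (rule functor_obj[OF Q_functor_Cc Z])
  have P: "?P \<in> Obj D" by (rule RQ_obj[OF Z])
  have qZ: "q Z \<in> hom C ?QZ Z" by (rule q_hom[OF Z])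
  have rQZ: "r ?QZ \<in> hom C ?QZ ?P" using rQ_hom(1)[OF Z] by simp
  have rQZ': "r ?QZ \<in> hom Cc ?QZ ?P" by (rule r_hom[OF QZ])
  have qQZ: "q ?QZ \<in> hom Cc (omap Q ?QZ) ?QZ" by (rule q_hom_Cc[OF QZ])
  have qP: "q ?P \<in> hom Cc (omap Q ?P) ?P" by (rule q_hom_Cc[OF obj_D_imp_Cc[OF P]])
  have hqZ: "amap R (amap Q (q Z)) \<in> hom D (omap R (omap Q ?QZ)) ?P"
    using functor_hom[OF RQ_functor qZ] by simp
  have hqP: "amap R (q ?P) \<in> hom D (omap R (omap Q ?P)) (omap R ?P)"
    by (rule functor_hom[OF R_functor qP])
  obtain s where s: "comparison H L Z = (Z, s, ?P)" and hs: "s \<in> hom Hfc ?P (omap R (omap Q ?P))"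
    using comparison_hom[OF L_inverts Z] by (auto simp: hom_H)
  have sq: "s \<cdot>\<^bsub>Hfc\<^esub> cls (amap R (amap Q (q Z))) = cls (amap R (amap Q (r ?QZ)))"
    using comparison_q[OF L_inverts Z] s L_simps(2)[OF qZ] L_simps(2)[OF rQZ] by simp
  have "cls (amap R (q ?P)) \<cdot>\<^bsub>Hfc\<^esub> s = cls (r ?P)"
  proof (rule Hfc.iso_cancel_right)
    show "is_iso Hfc (cls (amap R (amap Q (q Z))))"
      using inverts_iso[OF KRQ q_W[OF Z]] by simp
    show "cls (amap R (amap Q (q Z))) \<in> hom Hfc (omap R (omap Q ?QZ)) ?P"
      by (rule cls_hom[OF hqZ])
    show "cls (amap R (q ?P)) \<cdot>\<^bsub>Hfc\<^esub> s \<in> hom Hfc ?P (omap R ?P)"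
      by (rule Hfc.cmp_in[OF hs cls_hom[OF hqP]])
    show "cls (r ?P) \<in> hom Hfc ?P (omap R ?P)" by (rule cls_hom[OF r_hom_D[OF P]])
    have "(cls (amap R (q ?P)) \<cdot>\<^bsub>Hfc\<^esub> s) \<cdot>\<^bsub>Hfc\<^esub> cls (amap R (amap Q (q Z)))
        = cls (amap R (q ?P)) \<cdot>\<^bsub>Hfc\<^esub> cls (amap R (amap Q (r ?QZ)))"
      using Hfc.cmp_assoc[OF cls_hom[OF hqZ] hs cls_hom[OF hqP]] sq by simp
    also have "\<dots> = cls (amap R (r ?QZ)) \<cdot>\<^bsub>Hfc\<^esub> cls (amap R (q ?QZ))"
      using functor_cmp[OF KRf functor_hom[OF Q_functor_Cc rQZ] qP] functor_cmp[OF KRf qQZ rQZ']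
        q_natural[OF rQZ] by simp
    also have "\<dots> = cls (r ?P) \<cdot>\<^bsub>Hfc\<^esub> cls (amap R (amap Q (q Z)))"
      using r_R_eq_R_r[OF K_inverts QZ] q_Q_eq_Q_q[OF K_inverts Z] by simp
    finally show "(cls (amap R (q ?P)) \<cdot>\<^bsub>Hfc\<^esub> s) \<cdot>\<^bsub>Hfc\<^esub> cls (amap R (amap Q (q Z))) = \<dots>" .
  qed
  then show ?thesis using that s hs by blast
qed

text \<open>
  Every arrow of \<open>H\<close> is, up to the comparison isomorphisms, an arrow in the image of \<open>L\<close>; this is what
  makes factorizations through \<open>L\<close> unique. By \<open>comparison_middle\<close> the claim reduces to the naturality
  of \<open>r\<close> and \<open>R q\<close> at \<open>k\<close>.
\<close>

lemma comparison_conjugates: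
  assumes X: "X \<in> Obj C" and Y: "Y \<in> Obj C" and k: "k \<in> hom D (omap RQ X) (omap RQ Y)"
  shows "comparison H L Y \<cdot>\<^bsub>H\<^esub> (X, cls k, Y) = amap L k \<cdot>\<^bsub>H\<^esub> comparison H L X"
proof -
  interpret Hfc: category Hfc by (rule category_Hfc)
  let ?X = "omap R (omap Q X)" and ?Y = "omap R (omap Q Y)"
  note KRf = inverts_functor[OF inverts_R[OF K_inverts]]
  have XD: "?X \<in> Obj D" and YD: "?Y \<in> Obj D" using RQ_obj X Y by blast+
  have k: "k \<in> hom D ?X ?Y" using k by simp
  have kC: "k \<in> hom C ?X ?Y" using k by (simp add: hom_D_iff)
  obtain s where s: "comparison H L X = (X, s, ?X)" "s \<in> hom Hfc ?X (omap R (omap Q ?X))"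
    "cls (amap R (q ?X)) \<cdot>\<^bsub>Hfc\<^esub> s = cls (r ?X)"
    using comparison_middle[OF X] .
  obtain t where t: "comparison H L Y = (Y, t, ?Y)" "t \<in> hom Hfc ?Y (omap R (omap Q ?Y))"
    "cls (amap R (q ?Y)) \<cdot>\<^bsub>Hfc\<^esub> t = cls (r ?Y)"
    using comparison_middle[OF Y] .
  have qX: "q ?X \<in> hom Cc (omap Q ?X) ?X" and qY: "q ?Y \<in> hom Cc (omap Q ?Y) ?Y"
    using q_hom_Cc obj_D_imp_Cc XD YD by blast+
  have hqX: "cls (amap R (q ?X)) \<in> hom Hfc (omap R (omap Q ?X)) (omap R ?X)"
    and hqY: "cls (amap R (q ?Y)) \<in> hom Hfc (omap R (omap Q ?Y)) (omap R ?Y)"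
    using functor_hom[OF KRf qX] functor_hom[OF KRf qY] by simp_all
  have hRQk: "cls (amap R (amap Q k)) \<in> hom Hfc (omap R (omap Q ?X)) (omap R (omap Q ?Y))"
    using cls_hom[OF functor_hom[OF RQ_functor kC]] by simp
  have Rk: "amap R k \<in> hom D (omap R ?X) (omap R ?Y)"
    by (rule functor_hom[OF R_functor hom_D_imp_Cc[OF k]])
  have "t \<cdot>\<^bsub>Hfc\<^esub> cls k = cls (amap R (amap Q k)) \<cdot>\<^bsub>Hfc\<^esub> s"
  proof (rule Hfc.iso_cancel_left)
    show "is_iso Hfc (cls (amap R (q ?Y)))"
      using inverts_iso[OF inverts_R[OF K_inverts], of "q ?Y"] q_W[OF D_obj[OF YD]] homD(1)[OF qY]
      by simp
    show "cls (amap R (q ?Y)) \<in> hom Hfc (omap R (omap Q ?Y)) (omap R ?Y)" by (rule hqY)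
    show "t \<cdot>\<^bsub>Hfc\<^esub> cls k \<in> hom Hfc ?X (omap R (omap Q ?Y))"
      by (rule Hfc.cmp_in[OF cls_hom[OF k] t(2)])
    show "cls (amap R (amap Q k)) \<cdot>\<^bsub>Hfc\<^esub> s \<in> hom Hfc ?X (omap R (omap Q ?Y))"
      by (rule Hfc.cmp_in[OF s(2) hRQk])
    have "cls (amap R (q ?Y)) \<cdot>\<^bsub>Hfc\<^esub> (t \<cdot>\<^bsub>Hfc\<^esub> cls k) = cls (r ?Y) \<cdot>\<^bsub>Hfc\<^esub> cls k"
      using Hfc.cmp_assoc[OF cls_hom[OF k] t(2) hqY] t(3) by simp
    also have "\<dots> = cls (amap R k) \<cdot>\<^bsub>Hfc\<^esub> cls (r ?X)"
      using cls_cmp[OF k r_hom_D[OF YD]] cls_cmp[OF r_hom_D[OF XD] Rk]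
        r_natural[OF hom_D_imp_Cc[OF k]] by simp
    also have "\<dots> = (cls (amap R k) \<cdot>\<^bsub>Hfc\<^esub> cls (amap R (q ?X))) \<cdot>\<^bsub>Hfc\<^esub> s"
      using Hfc.cmp_assoc[OF s(2) hqX cls_hom[OF Rk]] s(3) by simp
    also have "cls (amap R k) \<cdot>\<^bsub>Hfc\<^esub> cls (amap R (q ?X))
        = cls (amap R (q ?Y)) \<cdot>\<^bsub>Hfc\<^esub> cls (amap R (amap Q k))"
      using functor_cmp[OF KRf qX hom_D_imp_Cc[OF k]]
        functor_cmp[OF KRf functor_hom[OF Q_functor_Cc kC] qY] q_natural[OF kC] by simp
    finally show "cls (amap R (q ?Y)) \<cdot>\<^bsub>Hfc\<^esub> (t \<cdot>\<^bsub>Hfc\<^esub> cls k)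
        = cls (amap R (q ?Y)) \<cdot>\<^bsub>Hfc\<^esub> (cls (amap R (amap Q k)) \<cdot>\<^bsub>Hfc\<^esub> s)"
      using Hfc.cmp_assoc[OF s(2) hRQk hqY] by simp
  qed
  then show ?thesis using s(1) t(1) kC by simp
qed

text \<open>
  Apply \<open>G\<close> to \<open>comparison_conjugates\<close>: the right-hand side depends only on \<open>F\<close>.
\<close>

lemma factorization_determined:
  assumes F: "inverts C W E F" and G: "is_functor H E G"
    and eq: "functor_eq C (comp_functor G L) F"
    and X: "X \<in> Obj C" and Y: "Y \<in> Obj C" and k: "k \<in> hom D (omap RQ X) (omap RQ Y)"
  shows "comparison E F Y \<cdot>\<^bsub>E\<^esub> amap G (X, cls k, Y) = amap F k \<cdot>\<^bsub>E\<^esub> comparison E F X"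
proof -
  have a: "(X, cls k, Y) \<in> hom H X Y" using X Y cls_hom[OF k] by (simp add: hom_H)
  have kC: "k \<in> hom C (omap RQ X) (omap RQ Y)" using k by (simp add: hom_D_iff)
  have "amap G (comparison H L Y \<cdot>\<^bsub>H\<^esub> (X, cls k, Y)) = amap G (amap L k \<cdot>\<^bsub>H\<^esub> comparison H L X)"
    using comparison_conjugates[OF X Y k] by simp
  then show ?thesis
    using functor_cmp[OF G a] functor_cmp[OF G _ functor_hom[OF L_functor kC]]
      comparison_hom[OF L_inverts X] comparison_hom[OF L_inverts Y]
      functor_comparison[OF L_inverts F G eq X] functor_comparison[OF L_inverts F G eq Y]
      functor_eq_arr[OF eq kC]
    by simp
qed

lemma factorization_unique:
  assumes F: "inverts C W E F"
    and G: "is_functor H E G" "functor_eq C (comp_functor G L) F"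
    and G': "is_functor H E G'" "functor_eq C (comp_functor G' L) F"
  shows "functor_eq H G' G"
proof -
  interpret E: category E by (rule functor_cats(2)[OF G(1)])
  have obj: "omap G X = omap F X" "omap G' X = omap F X" if "X \<in> Obj C" for X
    using functor_eq_obj[OF G(2) that] functor_eq_obj[OF G'(2) that] by simp_all
  have "amap G' a = amap G a" if a: "a \<in> hom H X Y" for a X Y
  proof -
    have X: "X \<in> Obj C" and Y: "Y \<in> Obj C" using a by (simp_all add: hom_H)
    obtain k where k: "k \<in> hom D (omap RQ X) (omap RQ Y)" and ak: "a = (X, cls k, Y)"
      using a by (auto simp: hom_H hom_quotient_cat)
    show ?thesis
    proof (rule E.iso_cancel_left)
      show "is_iso E (comparison E F Y)" by (rule comparison_iso[OF F Y])
      show "comparison E F Y \<in> hom E (omap F Y) (omap F (omap RQ Y))"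
        by (rule comparison_hom[OF F Y])
      show "amap G' a \<in> hom E (omap F X) (omap F Y)" "amap G a \<in> hom E (omap F X) (omap F Y)"
        using functor_hom[OF G(1) a] functor_hom[OF G'(1) a] obj X Y by simp_all
      show "comparison E F Y \<cdot>\<^bsub>E\<^esub> amap G' a = comparison E F Y \<cdot>\<^bsub>E\<^esub> amap G a"
        using factorization_determined[OF F G X Y k] factorization_determined[OF F G' X Y k] ak
        by simp
    qed
  qed
  then show ?thesis using obj by (auto simp: functor_eq_def dest: homI)
qed

text \<open>
  A factorization of \<open>F\<close> through \<open>\<gamma>\<close> on \<open>D\<close> provides \<open>compat\<close>, which makes \<open>F(k)\<close> depend only on
  the class of \<open>k\<close>. So \<open>(X, [k], Y)\<close> can be sent to the conjugate of \<open>F(k)\<close> by the comparison, and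
  naturality of the comparison gives \<open>F\<close> back on the image of \<open>L\<close>.
\<close>

lemma factorization_exists:
  assumes F: "inverts C W E F"
    and compat: "\<And>f g X Y. f \<in> hom D X Y \<Longrightarrow> g \<in> hom D X Y \<Longrightarrow> amap \<gamma> f = amap \<gamma> g \<Longrightarrow>
      amap F f = amap F g"
  obtains G where "is_functor H E G" "functor_eq C (comp_functor G L) F"
proof -
  note Ff = inverts_functor[OF F]
  interpret E: category E by (rule functor_cats(2)[OF Ff])
  interpret H: category H by (rule category_H)
  let ?c = "comparison E F"
  define G where
    "G = \<lparr>omap = omap F,
      amap = \<lambda>(X, \<kappa>, Y). inverse_arr E (?c Y) \<cdot>\<^bsub>E\<^esub> (amap F (SOME k. k \<in> \<kappa>) \<cdot>\<^bsub>E\<^esub> ?c X)\<rparr>"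
  have G_obj: "omap G X = omap F X" for X by (simp add: G_def)
  have hk: "amap F k \<cdot>\<^bsub>E\<^esub> ?c X \<in> hom E (omap F X) (omap F (omap RQ Y))"
    if "X \<in> Obj C" "k \<in> hom D (omap RQ X) (omap RQ Y)" for X Y k
    using E.cmp_in[OF comparison_hom[OF F that(1)] functor_hom[OF Ff]] that(2)
    by (simp add: hom_D_iff)
  have G_arr: "amap G (X, cls k, Y) = inverse_arr E (?c Y) \<cdot>\<^bsub>E\<^esub> (amap F k \<cdot>\<^bsub>E\<^esub> ?c X)"
    if k: "k \<in> hom D (omap RQ X) (omap RQ Y)" for X Y k
  proof -
    have "k \<in> cls k" using homotopical_iff[OF k, of k \<gamma>] k by simp
    then have "(SOME k'. k' \<in> cls k) \<in> cls k" by (rule someI)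
    then have "(SOME k'. k' \<in> cls k) \<in> hom D (omap RQ X) (omap RQ Y)
        \<and> amap \<gamma> (SOME k'. k' \<in> cls k) = amap \<gamma> k"
      using homotopical_iff[OF k, of _ \<gamma>] by simp
    then have "amap F (SOME k'. k' \<in> cls k) = amap F k" using compat k by blast
    then show ?thesis by (simp add: G_def)
  qed
  have G_hom: "amap G (X, cls k, Y) \<in> hom E (omap F X) (omap F Y)"
    and G_conj: "?c Y \<cdot>\<^bsub>E\<^esub> amap G (X, cls k, Y) = amap F k \<cdot>\<^bsub>E\<^esub> ?c X"
    if X: "X \<in> Obj C" and Y: "Y \<in> Obj C" and k: "k \<in> hom D (omap RQ X) (omap RQ Y)" for X Y k
  proof -
    note inv = E.inverse_arr[OF comparison_iso[OF F Y] comparison_hom[OF F Y]]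
    show "amap G (X, cls k, Y) \<in> hom E (omap F X) (omap F Y)"
      using E.cmp_in[OF hk[OF X k] inv(1)] G_arr[OF k] by simp
    show "?c Y \<cdot>\<^bsub>E\<^esub> amap G (X, cls k, Y) = amap F k \<cdot>\<^bsub>E\<^esub> ?c X"
      using E.cmp_assoc[OF hk[OF X k] inv(1) comparison_hom[OF F Y]] inv(3)
        E.ide_left[OF hk[OF X k]] G_arr[OF k] by simp
  qed
  \<comment> \<open>Since the comparison is cancellable, an equation for \<open>G\<close> reduces to one for \<open>F\<close>.\<close>
  have G_eqI: "amap G (X, cls k, Y) = g"
    if X: "X \<in> Obj C" and Y: "Y \<in> Obj C" and k: "k \<in> hom D (omap RQ X) (omap RQ Y)"
      and g: "g \<in> hom E (omap F X) (omap F Y)" "?c Y \<cdot>\<^bsub>E\<^esub> g = amap F k \<cdot>\<^bsub>E\<^esub> ?c X" for X Y k g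
    using E.iso_cancel_left[OF comparison_iso[OF F Y] comparison_hom[OF F Y] G_hom[OF X Y k] g(1)]
      G_conj[OF X Y k] g(2) by simp
  have GL: "amap G (amap L f) = amap F f" if f: "f \<in> hom C X Y" for f X Y
    using G_eqI[OF hom_objs[OF f] functor_hom[OF RQ_functor f] functor_hom[OF Ff f]
        comparison_natural[OF F f]] f by simp
  have "is_functor H E G"
  proof (rule is_functorI)
    show "amap G a \<in> hom E (omap G X) (omap G Y)" if a: "a \<in> hom H X Y" for a X Y
      using a G_hom by (auto simp: hom_H hom_quotient_cat G_obj)
    show "amap G (Ide H X) = Ide E (omap G X)" if "X \<in> Obj H" for X
    proof -
      have X: "X \<in> Obj C" using that by simp
      show ?thesis
        using GL[OF ide_in[OF X]] functor_ide[OF L_functor X] functor_ide[OF Ff X]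
        by (simp add: G_obj)
    qed
    show "amap G (b \<cdot>\<^bsub>H\<^esub> a) = amap G b \<cdot>\<^bsub>E\<^esub> amap G a"
      if a: "a \<in> hom H X Y" and b: "b \<in> hom H Y Z" for a b X Y Z
    proof -
      have X: "X \<in> Obj C" and Y: "Y \<in> Obj C" and Z: "Z \<in> Obj C"
        using a b by (simp_all add: hom_H)
      obtain k where k: "k \<in> hom D (omap RQ X) (omap RQ Y)" and ak: "a = (X, cls k, Y)"
        using a by (auto simp: hom_H hom_quotient_cat)
      obtain l where l: "l \<in> hom D (omap RQ Y) (omap RQ Z)" and bl: "b = (Y, cls l, Z)"
        using b by (auto simp: hom_H hom_quotient_cat)
      have lk: "l \<cdot> k \<in> hom D (omap RQ X) (omap RQ Z)"
        using category.cmp_in[OF category_D k l] by simp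
      have kC: "k \<in> hom C (omap RQ X) (omap RQ Y)" and lC: "l \<in> hom C (omap RQ Y) (omap RQ Z)"
        using k l by (simp_all add: hom_D_iff)
      note Fk = functor_hom[OF Ff kC] and Fl = functor_hom[OF Ff lC]
      note Ga = G_hom[OF X Y k, folded ak] and Gb = G_hom[OF Y Z l, folded bl]
      have "?c Z \<cdot>\<^bsub>E\<^esub> (amap G b \<cdot>\<^bsub>E\<^esub> amap G a) = (amap F l \<cdot>\<^bsub>E\<^esub> ?c Y) \<cdot>\<^bsub>E\<^esub> amap G a"
        using E.cmp_assoc[OF Ga Gb comparison_hom[OF F Z]] G_conj[OF Y Z l] bl by simp
      also have "\<dots> = amap F l \<cdot>\<^bsub>E\<^esub> (amap F k \<cdot>\<^bsub>E\<^esub> ?c X)"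
        using E.cmp_assoc[OF Ga comparison_hom[OF F Y] Fl] G_conj[OF X Y k] ak by simp
      also have "\<dots> = amap F (l \<cdot> k) \<cdot>\<^bsub>E\<^esub> ?c X"
        using E.cmp_assoc[OF comparison_hom[OF F X] Fk Fl] functor_cmp[OF Ff kC lC] by simp
      finally have "amap G (X, cls (l \<cdot> k), Z) = amap G b \<cdot>\<^bsub>E\<^esub> amap G a"
        by (rule G_eqI[OF X Z lk E.cmp_in[OF Ga Gb]])
      then show ?thesis using cls_cmp[OF k l] ak bl by simp
    qed
  qed (simp_all add: category_H E.category_axioms G_obj functor_obj[OF Ff])
  moreover have "functor_eq C (comp_functor G L) F"
    using GL by (auto simp: functor_eq_def G_obj dest: homI)
  ultimately show ?thesis by (rule that)
qed

end

end

theorem theorem3p5p16: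
  fixes C :: "('o, 'a) cat" and W Fib Cof :: "'a set"
    and Q R :: "('o, 'a, 'o, 'a) cfunctor" and q r :: "'o \<Rightarrow> 'a"
    and Ho_fc :: "('p, 'b) cat" and \<gamma>0 :: "('o, 'a, 'p, 'b) cfunctor"
  assumes "model_category C W Fib Cof"
    and "cofibrant_replacement C W Cof Q q"
    and "fibrant_replacement C W Fib Cof R r"
    and "is_localization TYPE('x) TYPE('y)
           (fibcof_cat C Fib Cof) (W \<inter> Arr (fibcof_cat C Fib Cof)) Ho_fc \<gamma>0"
  shows "is_localization TYPE('x) TYPE('y)
           C W (homotopy_cat C Fib Cof Q R \<gamma>0) (homotopy_functor C Fib Cof Q R \<gamma>0)"
proof -
  interpret model_with_replacements C W Fib Cof Q R q r
    by (intro model_with_replacements.intro model_with_replacements_axioms.intro assms(1-3))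
  have \<gamma>: "inverts D (W \<inter> Arr D) Ho_fc \<gamma>0"
    using assms(4) by (simp add: is_localization_def)
  let ?H = "homotopy_cat C Fib Cof Q R \<gamma>0" and ?L = "homotopy_functor C Fib Cof Q R \<gamma>0"
  have "\<exists>G. is_functor ?H E G \<and> functor_eq C (comp_functor G ?L) F
      \<and> (\<forall>G'. is_functor ?H E G' \<and> functor_eq C (comp_functor G' ?L) F \<longrightarrow> functor_eq ?H G' G)"
    if F: "inverts C W E F" for E :: "('x, 'y) cat" and F
  proof -
    have "inverts D (W \<inter> Arr D) E F"
      using F functor_full_subcat by (auto simp: inverts_def fibcof_cat_def)
    then obtain G\<^sub>0 where G\<^sub>0: "functor_eq D (comp_functor G\<^sub>0 \<gamma>0) F"
      using assms(4) unfolding is_localization_def by blast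
    have "amap F f = amap F g"
      if "f \<in> hom D X Y" "g \<in> hom D X Y" "amap \<gamma>0 f = amap \<gamma>0 g" for f g X Y
      using functor_eq_arr[OF G\<^sub>0 that(1)] functor_eq_arr[OF G\<^sub>0 that(2)] that(3) by simp
    then obtain G where G: "is_functor ?H E G" "functor_eq C (comp_functor G ?L) F"
      using factorization_exists[OF \<gamma> F] by blast
    then show ?thesis using factorization_unique[OF \<gamma> F G] by blast
  qed
  then show ?thesis
    using L_inverts[OF \<gamma>] unfolding is_localization_def by blast
qed

end
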